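(* Let $k\geq 4$ and $2\leq d\leq k-2$. Let $X_{k,d}^2$ consist of the three patterns $321$, $(d+1,d+2,\dots,k-1,1,k,2,3,\dots,d)$ and $(d+1,d+2,\dots,k-1,k,1,2,\dots,d)$, and let $x_{k,d}^2(n)$ be the number of permutations in $S_n$ avoiding all patterns of $X_{k,d}^2$. Then for all $n\geq k$, $$\sum_{j=0}^{k-1}(-1)^j\binom{k-1-j}{j}x_{k,d}^2(n-j)=\sum_{j=0}^{k-1}(-1)^j\binom{k-1-j}{j}x_{k,d}^2(n-1-j)+\sum_{j=0}^{k-4}(-1)^j\binom{k-4-j}{j}x_{k,d}^2(n-3-j),$$ $x_{k,d}^2(n)=\frac{1}{n+1}\binom{2n}{n}$ for all $0\leq n\leq k-1$, and $$\sum_{n\geq0}x_{k,d}^2(n)x^n=\dfrac{U_{k-1}\left(\frac{1}{2\sqrt{x}}\right)+xU_{k-3}\left(\frac{1}{2\sqrt{x}}\right)}{\sqrt{x}\left[U_k\left(\frac{1}{2\sqrt{x}}\right)+xU_{k-2}\left(\frac{1}{2\sqrt{x}}\right)\right]}.$$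
   Context: A permutation $\alpha\in S_n$ contains a pattern $\tau\in S_m$ if there are indices $i_1<\dots<i_m$ with $(\alpha_{i_1},\dots,\alpha_{i_m})$ order-isomorphic to $\tau$; otherwise it avoids $\tau$. $U_m$ is the Chebyshev polynomial of the second kind, $U_m(\cos\theta)=\sin((m+1)\theta)/\sin\theta$. *)

theory Defs
  imports
    "HOL-Analysis.Analysis"
    "HOL-Combinatorics.Combinatorics"
    "HOL-Computational_Algebra.Computational_Algebra"
begin

section \<open>Pattern avoidance\<close>

text \<open>
  Permutations are written in one-line notation: the symmetric group on \<open>{1..n}\<close> is
  \<^term>\<open>permutations_of_set {1..n}\<close>, a set of lists, and the patterns are lists as well.
\<close>

definition contains_pattern :: "nat list \<Rightarrow> nat list \<Rightarrow> bool" where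
  "contains_pattern \<alpha> \<tau> \<longleftrightarrow>
     (\<exists>i :: nat \<Rightarrow> nat.
        strict_mono_on {..<length \<tau>} i \<and>
        (\<forall>a<length \<tau>. i a < length \<alpha>) \<and>
        (\<forall>a<length \<tau>. \<forall>b<length \<tau>. \<alpha> ! i a < \<alpha> ! i b \<longleftrightarrow> \<tau> ! a < \<tau> ! b))"

definition avoiders :: "nat list set \<Rightarrow> nat \<Rightarrow> nat list set" where
  "avoiders T n = {\<alpha> \<in> permutations_of_set {1..n}. \<forall>\<tau>\<in>T. \<not> contains_pattern \<alpha> \<tau>}"

definition patterns_X2 :: "nat \<Rightarrow> nat \<Rightarrow> nat list set" where
  "patterns_X2 k d =
     {[3, 2, 1],
      [d + 1..<k] @ [1, k] @ [2..<d + 1],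
      [d + 1..<k + 1] @ [1..<d + 1]}"

definition x2 :: "nat \<Rightarrow> nat \<Rightarrow> nat \<Rightarrow> nat" where
  "x2 k d n = card (avoiders (patterns_X2 k d) n)"


section \<open>Chebyshev polynomials of the second kind\<close>

definition chebyshev_U :: "nat \<Rightarrow> real poly" where
  "chebyshev_U m =
     (THE p. \<forall>\<theta>. sin \<theta> \<noteq> 0 \<longrightarrow> poly p (cos \<theta>) = sin (real (m + 1) * \<theta>) / sin \<theta>)"

lemma chebyshev_U_unique:
  fixes p q :: "real poly"
  assumes "\<And>\<theta>. sin \<theta> \<noteq> 0 \<Longrightarrow> poly p (cos \<theta>) = poly q (cos \<theta>)"
  shows "p = q"
proof (rule ccontr)
  assume "p \<noteq> q"
  then have "finite {x. poly (p - q) x = 0}"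
    by (intro poly_roots_finite) simp
  moreover have "{-1<..<1} \<subseteq> {x. poly (p - q) x = 0}"
  proof
    fix x :: real
    assume x: "x \<in> {-1<..<1}"
    have "sin (arccos x) \<noteq> 0"
      using x by (intro sin_arccos_nonzero) auto
    from assms[OF this] x show "x \<in> {x. poly (p - q) x = 0}"
      by simp
  qed
  ultimately have "finite {-1<..<1::real}"
    by (rule rev_finite_subset)
  then show False
    using infinite_Ioo[of "-1::real" 1] by simp
qed

lemma chebyshev_U_exists:
  "\<exists>p::real poly. \<forall>\<theta>. sin \<theta> \<noteq> 0 \<longrightarrow> poly p (cos \<theta>) = sin (real (m + 1) * \<theta>) / sin \<theta>"
proof (induction m rule: less_induct)
  case (less m)
  consider "m = 0" | "m = 1" | l where "m = Suc (Suc l)"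
    by (metis One_nat_def not0_implies_Suc)
  then show ?case
  proof cases
    case 1
    then show ?thesis by (intro exI[of _ 1]) simp
  next
    case 2
    then show ?thesis by (intro exI[of _ "[:0, 2:]"]) (simp add: sin_double)
  next
    case 3
    obtain p where p: "\<And>\<theta>. sin \<theta> \<noteq> 0 \<Longrightarrow> poly p (cos \<theta>) = sin (real (l + 1) * \<theta>) / sin \<theta>"
      using less[of l] 3 by auto
    obtain q where q: "\<And>\<theta>. sin \<theta> \<noteq> 0 \<Longrightarrow> poly q (cos \<theta>) = sin (real (l + 2) * \<theta>) / sin \<theta>"
      using less[of "Suc l"] 3 by (auto simp: add.commute)
    have "poly ([:0, 2:] * q - p) (cos \<theta>) = sin (real (m + 1) * \<theta>) / sin \<theta>"
      if "sin \<theta> \<noteq> 0" for \<theta>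
    proof -
      let ?a = "real (l + 2) * \<theta>"
      have "sin (?a + \<theta>) = 2 * cos \<theta> * sin ?a - sin (?a - \<theta>)"
        by (simp add: sin_add sin_diff)
      moreover have "?a + \<theta> = real (m + 1) * \<theta>" "?a - \<theta> = real (l + 1) * \<theta>"
        using 3 by (simp_all add: algebra_simps)
      ultimately show ?thesis
        using that by (simp add: p q diff_divide_distrib)
    qed
    then show ?thesis by blast
  qed
qed

lemma poly_chebyshev_U_cos:
  assumes "sin \<theta> \<noteq> 0"
  shows "poly (chebyshev_U m) (cos \<theta>) = sin (real (m + 1) * \<theta>) / sin \<theta>"
proof -
  have "\<exists>!p::real poly. \<forall>\<theta>. sin \<theta> \<noteq> 0 \<longrightarrow> poly p (cos \<theta>) = sin (real (m + 1) * \<theta>) / sin \<theta>"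
    using chebyshev_U_exists[of m] by (auto intro!: chebyshev_U_unique)
  from theI'[OF this] assms show ?thesis
    unfolding chebyshev_U_def by blast
qed

text \<open>
  The indeterminate \<^term>\<open>fls_X\<close> of the field of formal Laurent series stands for \<open>\<surd>x\<close>; thus \<open>x\<close>
  is \<^term>\<open>fls_X ^ 2\<close> and \<open>U_at m\<close> is \<open>U\<^sub>m(1 / (2 \<surd>x))\<close>.
\<close>

definition U_at :: "nat \<Rightarrow> real fls" where
  "U_at m = poly (map_poly fls_const (chebyshev_U m)) (1 / (2 * fls_X))"

end

theory Submission
  imports Defs "HOL-Library.Sublist"
begin

text \<open>
  Let \<open>f(i, l; n)\<close> count the avoiders of length \<open>n\<close> whose first \<open>i\<close> entries are increasing and larger than
  \<open>l\<close> and whose entries \<open>1, \<dots>, l\<close> appear in increasing order. Asking whether entry number \<open>i + 1\<close> is at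
  most \<open>l\<close> (it must then be \<open>1\<close>, and deleting it is harmless) or whether \<open>l + 1\<close> is among the first
  \<open>i\<close> entries (it must then be the very first one) gives
  \<open>f(i + 1, l; n) = f(i, l; n) - f(i, l - 1; n - 1)\<close> and
  \<open>f(i, l + 1; n) = f(i, l; n) - f(i - 1, l; n - 1)\<close> as long as the first argument stays below
  \<open>k - d\<close> and the second is at most \<open>d\<close>. Hence, for \<open>i + l = m \<le> n\<close>, \<open>f(i, l; n)\<close> is the \<open>n\<close>-th coefficient of \<open>p\<^sub>m F\<close>, where \<open>F\<close> is the generating function
  and \<open>p\<^sub>m = p\<^bsub>m-1\<^esub> - x p\<^bsub>m-2\<^esub>\<close>, a rescaled Chebyshev polynomial. The two long patterns only matter at the
  corner \<open>(i, l) = (k - d - 1, d)\<close>: there the avoider continues with \<open>1, 2\<close>, which yields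
  \<open>f(i, d; n) = f(i, d - 1; n - 1) - f(i, d - 1; n - 2)\<close>, that is,
  \<open>(p\<^bsub>k-1\<^esub> - x p\<^bsub>k-2\<^esub> + x\<^sup>2 p\<^bsub>k-2\<^esub>) F\<close> has no terms of degree \<open>\<ge> k\<close>. For \<open>i + l = n < k\<close> there is exactly one
  such permutation, so the \<open>f(i, l; n)\<close> with \<open>n < k\<close> are the ballot numbers and \<open>F\<close> starts with the
  Catalan numbers.
\<close>

section \<open>Patterns as order-isomorphic subsequences\<close>

definition order_iso :: "nat list \<Rightarrow> nat list \<Rightarrow> bool" where
  "order_iso \<beta> \<tau> \<longleftrightarrow> length \<beta> = length \<tau> \<and>
     (\<forall>a<length \<tau>. \<forall>b<length \<tau>. \<beta> ! a < \<beta> ! b \<longleftrightarrow> \<tau> ! a < \<tau> ! b)"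

lemma order_iso_map:
  assumes "strict_mono_on (set \<tau>) f"
  shows "order_iso (map f \<tau>) \<tau>"
  using assms by (auto simp: order_iso_def strict_mono_on_less)

lemma order_iso_map_left:
  assumes "strict_mono_on (set \<beta>) f"
  shows "order_iso (map f \<beta>) \<tau> \<longleftrightarrow> order_iso \<beta> \<tau>"
proof -
  have "f (\<beta> ! a) < f (\<beta> ! b) \<longleftrightarrow> \<beta> ! a < \<beta> ! b" if "a < length \<beta>" "b < length \<beta>" for a b
    using assms that by (auto simp: strict_mono_on_less)
  then show ?thesis by (auto simp: order_iso_def)
qed

lemma subseq_imp_strict_mono_index:
  assumes "subseq \<beta> \<alpha>"
  shows "\<exists>i. strict_mono_on {..<length \<beta>} i \<and> (\<forall>a<length \<beta>. i a < length \<alpha> \<and> \<alpha> ! i a = \<beta> ! a)"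
  using assms
proof (induction rule: list_emb.induct)
  case (list_emb_Nil ys)
  then show ?case by (auto simp: strict_mono_on_def)
next
  case (list_emb_Cons xs ys y)
  then obtain i where "strict_mono_on {..<length xs} i" 
    "\<forall>a<length xs. i a < length ys \<and> ys ! i a = xs ! a" by blast
  then show ?case
    by (intro exI[of _ "\<lambda>a. Suc (i a)"]) (auto simp: strict_mono_on_def)
next
  case (list_emb_Cons2 x y xs ys)
  then obtain i where i: "strict_mono_on {..<length xs} i" 
    "\<forall>a<length xs. i a < length ys \<and> ys ! i a = xs ! a" by blast
  then show ?case using list_emb_Cons2
    by (intro exI[of _ "case_nat 0 (\<lambda>a. Suc (i a))"])
       (auto simp: strict_mono_on_def less_Suc_eq_0_disj split: nat.splits)
qed

text \<open>The bound \<open>q\<close> is there for the induction on \<open>m\<close>: all earlier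
  indices lie below \<open>i m\<close>, so the induction hypothesis applies to
  \<open>take (i m) \<alpha>\<close>, and the last entry is appended to it.\<close>

lemma strict_mono_index_imp_subseq:
  assumes "strict_mono_on {..<m} i" "\<forall>a<m. i a < q" "q \<le> length \<alpha>"
  shows "subseq (map (\<lambda>a. \<alpha> ! i a) [0..<m]) (take q \<alpha>)"
  using assms
proof (induction m arbitrary: q)
  case (Suc m)
  have "subseq (map (\<lambda>a. \<alpha> ! i a) [0..<m]) (take (i m) \<alpha>)"
    using Suc.prems by (intro Suc.IH) (auto simp: strict_mono_on_def order.strict_implies_order)
  then have "subseq (map (\<lambda>a. \<alpha> ! i a) [0..<m] @ [\<alpha> ! i m]) (take (i m) \<alpha> @ [\<alpha> ! i m])"
    by simp
  also have "take (i m) \<alpha> @ [\<alpha> ! i m] = take (Suc (i m)) \<alpha>"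
    using Suc.prems by (subst take_Suc_conv_app_nth) (auto simp: less_le_trans)
  also have "subseq \<dots> (take q \<alpha>)"
    using Suc.prems by (metis Suc_leI lessI min.absorb1 subseq_order.order_refl take_is_prefix take_take
        prefix_imp_subseq)
  finally show ?case by simp
qed simp

text \<open>Replaces index functions by subsequences, so that an occurrence can be cut at an
  inserted entry by \<open>subseq_append_iff\<close>.\<close>

lemma contains_pattern_iff_subseq:
  "contains_pattern \<alpha> \<tau> \<longleftrightarrow> (\<exists>\<beta>. subseq \<beta> \<alpha> \<and> order_iso \<beta> \<tau>)"
proof
  assume "contains_pattern \<alpha> \<tau>"
  then obtain i where i: "strict_mono_on {..<length \<tau>} i" "\<forall>a<length \<tau>. i a < length \<alpha>"
      "\<forall>a<length \<tau>. \<forall>b<length \<tau>. \<alpha> ! i a < \<alpha> ! i b \<longleftrightarrow> \<tau> ! a < \<tau> ! b"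
    unfolding contains_pattern_def by blast
  have "subseq (map (\<lambda>a. \<alpha> ! i a) [0..<length \<tau>]) \<alpha>"
    using strict_mono_index_imp_subseq[OF i(1,2) order_refl] by simp
  with i(3) show "\<exists>\<beta>. subseq \<beta> \<alpha> \<and> order_iso \<beta> \<tau>"
    by (intro exI[of _ "map (\<lambda>a. \<alpha> ! i a) [0..<length \<tau>]"]) (auto simp: order_iso_def)
next
  assume "\<exists>\<beta>. subseq \<beta> \<alpha> \<and> order_iso \<beta> \<tau>"
  then obtain \<beta> where b: "subseq \<beta> \<alpha>" "order_iso \<beta> \<tau>" by blast
  from subseq_imp_strict_mono_index[OF b(1)] b(2) show "contains_pattern \<alpha> \<tau>"
    unfolding contains_pattern_def order_iso_def by metis
qed

lemma contains_pattern_subseq: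
  assumes "contains_pattern \<beta> \<tau>" "subseq \<beta> \<alpha>"
  shows "contains_pattern \<alpha> \<tau>"
  using assms by (meson contains_pattern_iff_subseq subseq_order.order_trans)

lemma contains_pattern_map:
  assumes "strict_mono f"
  shows "contains_pattern (map f \<alpha>) \<tau> \<longleftrightarrow> contains_pattern \<alpha> \<tau>"
proof -
  have "subseq \<beta> (map f \<alpha>) \<longleftrightarrow> (\<exists>\<gamma>. \<beta> = map f \<gamma> \<and> subseq \<gamma> \<alpha>)" for \<beta>
    by (auto simp: subseq_conv_nths nths_map)
  moreover have "order_iso (map f \<gamma>) \<tau> \<longleftrightarrow> order_iso \<gamma> \<tau>" for \<gamma>
    using assms by (intro order_iso_map_left) (auto simp: strict_mono_def strict_mono_on_def)
  ultimately show ?thesis unfolding contains_pattern_iff_subseq by auto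
qed

lemma contains_321_iff:
  "contains_pattern \<alpha> [3, 2, 1] \<longleftrightarrow> (\<exists>x y z. subseq [x, y, z] \<alpha> \<and> z < y \<and> y < x)"
proof -
  have "order_iso \<beta> [3, 2, 1] \<longleftrightarrow> (\<exists>x y z. \<beta> = [x, y, z] \<and> z < y \<and> y < x)" for \<beta>
    by (auto simp: order_iso_def length_Suc_conv numeral_3_eq_3 less_Suc_eq)
  then show ?thesis unfolding contains_pattern_iff_subseq by metis
qed

lemma contains_pattern_length:
  "contains_pattern \<alpha> \<tau> \<Longrightarrow> length \<tau> \<le> length \<alpha>"
  by (metis contains_pattern_iff_subseq list_emb_length order_iso_def)

lemma nth_append_Cons_mem:
  assumes "j < length (b1 @ v # b2)" "j \<noteq> length b1"
  shows "(b1 @ v # b2) ! j \<in> set b1 \<union> set b2"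
  using assms by (auto simp: nth_append nth_Cons split: nat.splits)

lemma order_isoD:
  assumes "order_iso \<beta> \<tau>" "a < length \<tau>" "b < length \<tau>"
  shows "\<beta> ! a < \<beta> ! b \<longleftrightarrow> \<tau> ! a < \<tau> ! b"
  using assms unfolding order_iso_def by blast

text \<open>If \<open>v\<close> sat at another index, the entry at index \<open>j\<close> would
  exceed \<open>v\<close>, so the pattern would have a value below its minimum. This fixes how many
  entries of an occurrence precede its least one.\<close>

lemma order_iso_min_index:
  assumes iso: "order_iso (b1 @ v # b2) \<tau>"
    and v: "\<forall>x\<in>set b1 \<union> set b2. v < x"
    and j: "j < length \<tau>" "\<forall>b<length \<tau>. \<tau> ! j \<le> \<tau> ! b"
  shows "length b1 = j"
proof (rule ccontr)
  assume ne: "length b1 \<noteq> j"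
  let ?\<beta> = "b1 @ v # b2"
  have len: "length ?\<beta> = length \<tau>" using iso by (simp add: order_iso_def)
  have "?\<beta> ! j \<in> set b1 \<union> set b2" using j(1) ne len by (intro nth_append_Cons_mem) auto
  then have "?\<beta> ! length b1 < ?\<beta> ! j" using v by simp
  moreover have "length b1 < length \<tau>" using len by simp
  ultimately have "\<tau> ! length b1 < \<tau> ! j" using order_isoD[OF iso _ j(1)] by blast
  then show False using j(2) len by (metis add_less_cancel_left length_append length_Cons less_add_same_cancel1 linorder_not_le zero_less_Suc)
qed

text \<open>Both \<open>v\<close> and \<open>w\<close> lie below all other entries, so every
  comparison keeps its outcome.\<close>

lemma order_iso_replace_min:
  assumes "order_iso (b1 @ v # b2) \<tau>" "\<forall>x\<in>set b1 \<union> set b2. v < x \<and> w < x"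
  shows "order_iso (b1 @ w # b2) \<tau>"
  unfolding order_iso_def
proof (intro conjI allI impI)
  show len: "length (b1 @ w # b2) = length \<tau>" using assms(1) by (simp add: order_iso_def)
  fix a b assume ab: "a < length \<tau>" "b < length \<tau>"
  have eq: "(b1 @ w # b2) ! c = (b1 @ v # b2) ! c" if "c \<noteq> length b1" for c
    using that by (auto simp: nth_append nth_Cons')
  have gt: "v < (b1 @ v # b2) ! c \<and> w < (b1 @ v # b2) ! c" if "c \<noteq> length b1" "c < length \<tau>" for c
    using nth_append_Cons_mem[of c b1 v b2] that assms(2) len by simp
  have "(b1 @ w # b2) ! a < (b1 @ w # b2) ! b \<longleftrightarrow> (b1 @ v # b2) ! a < (b1 @ v # b2) ! b"
    using eq[of a] eq[of b] gt[of a] gt[of b] ab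
    by (cases "a = length b1"; cases "b = length b1") (auto dest: less_imp_not_less)
  also have "\<dots> \<longleftrightarrow> \<tau> ! a < \<tau> ! b" using order_isoD[OF assms(1) ab] .
  finally show "(b1 @ w # b2) ! a < (b1 @ w # b2) ! b \<longleftrightarrow> \<tau> ! a < \<tau> ! b" .
qed

lemma not_sorted_subseq:
  "\<not> sorted (xs :: nat list) \<Longrightarrow> \<exists>x y. subseq [x, y] xs \<and> y < x"
proof (induction xs)
  case (Cons z xs)
  show ?case
  proof (cases "sorted xs")
    case True
    then obtain y where "y \<in> set xs" "y < z" using Cons.prems by force
    then show ?thesis by (intro exI[of _ z] exI[of _ y]) (auto simp: subseq_singleton_left)
  next
    case False
    then show ?thesis using Cons.IH by (meson list_emb_Cons)
  qed
qed simp

lemma subseq_set_subset: "subseq xs ys \<Longrightarrow> set xs \<subseteq> set ys"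
  by (auto dest: list_emb_set)

lemma sorted_subseq:
  "subseq xs ys \<Longrightarrow> sorted (ys :: nat list) \<Longrightarrow> sorted xs"
  by (induction rule: list_emb.induct) (auto dest: list_emb_set)

lemma subseq_filter_self: "subseq (filter P xs) xs"
  by (induction xs) auto

section \<open>Inserting an entry into a permutation\<close>

definition shift_from :: "nat \<Rightarrow> nat \<Rightarrow> nat" where
  "shift_from v x = (if x < v then x else Suc x)"

text \<open>The inverse of deleting the entry \<open>v\<close> at index \<open>i\<close> (counted
  from 0) and standardising what remains.\<close>

definition insert_entry :: "nat \<Rightarrow> nat \<Rightarrow> nat list \<Rightarrow> nat list" where
  "insert_entry v i \<beta> = take i (map (shift_from v) \<beta>) @ v # drop i (map (shift_from v) \<beta>)"

lemma strict_mono_shift_from: "strict_mono (shift_from v)"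
  by (auto simp: strict_mono_def shift_from_def)

lemma less_shift_from_iff [simp]: "v < shift_from v x \<longleftrightarrow> v \<le> x"
  by (simp add: shift_from_def)

lemma contains_insert_entry:
  assumes "contains_pattern \<beta> \<tau>"
  shows "contains_pattern (insert_entry v i \<beta>) \<tau>"
proof (rule contains_pattern_subseq)
  show "contains_pattern (map (shift_from v) \<beta>) \<tau>"
    using assms by (simp add: contains_pattern_map strict_mono_shift_from)
  have "subseq (take i (map (shift_from v) \<beta>) @ drop i (map (shift_from v) \<beta>)) (insert_entry v i \<beta>)"
    unfolding insert_entry_def by (intro list_emb_append_mono) auto
  then show "subseq (map (shift_from v) \<beta>) (insert_entry v i \<beta>)"
    by (simp only: append_take_drop_id)
qed

text \<open>An occurrence that misses the inserted entry lies in the shifted copy of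
  \<open>\<beta>\<close>, hence comes from \<open>\<beta>\<close> itself; a new occurrence therefore
  passes through \<open>v\<close>.\<close>

lemma contains_insert_entryE:
  assumes "contains_pattern (insert_entry v i \<beta>) \<tau>" "\<not> contains_pattern \<beta> \<tau>"
  obtains b1 b2 where "subseq b1 (take i (map (shift_from v) \<beta>))"
    "subseq b2 (drop i (map (shift_from v) \<beta>))" "order_iso (b1 @ v # b2) \<tau>"
proof -
  let ?xs = "take i (map (shift_from v) \<beta>)" and ?ys = "drop i (map (shift_from v) \<beta>)"
  from assms(1) obtain \<gamma> where g: "subseq \<gamma> (?xs @ v # ?ys)" "order_iso \<gamma> \<tau>"
    unfolding contains_pattern_iff_subseq insert_entry_def by blast
  from g(1) obtain b1 c where c: "\<gamma> = b1 @ c" "subseq b1 ?xs" "subseq c (v # ?ys)"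
    by (auto simp: subseq_append_iff)
  have "\<not> subseq c ?ys"
  proof
    assume "subseq c ?ys"
    then have "subseq \<gamma> (?xs @ ?ys)" unfolding c(1) using c(2) by (intro list_emb_append_mono)
    then have "contains_pattern (map (shift_from v) \<beta>) \<tau>"
      using g(2) unfolding contains_pattern_iff_subseq append_take_drop_id by blast
    with assms(2) show False by (simp add: contains_pattern_map strict_mono_shift_from)
  qed
  with c(3) obtain b2 where "c = v # b2" "subseq b2 ?ys"
    by (cases c) (auto split: if_splits)
  with that c g show thesis by blast
qed

lemma insert_entry_permutation:
  assumes "\<beta> \<in> permutations_of_set {1..n}" "1 \<le> v" "v \<le> Suc n"
  shows "insert_entry v i \<beta> \<in> permutations_of_set {1..Suc n}"
proof -
  have "shift_from v ` {1..n} = {1..Suc n} - {v}"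
  proof
    show "{1..Suc n} - {v} \<subseteq> shift_from v ` {1..n}"
    proof
      fix x assume "x \<in> {1..Suc n} - {v}"
      then show "x \<in> shift_from v ` {1..n}" using assms(2,3)
        by (intro image_eqI[of _ _ "if x < v then x else x - 1"]) (auto simp: shift_from_def)
    qed
  qed (use assms in \<open>auto simp: shift_from_def\<close>)
  moreover have "distinct (map (shift_from v) \<beta>)"
    using assms(1) strict_mono_shift_from[of v]
    by (auto simp: distinct_map permutations_of_set_def strict_mono_imp_inj_on)
  moreover have "mset (insert_entry v i \<beta>) = mset (v # map (shift_from v) \<beta>)"
    unfolding insert_entry_def by (metis append_take_drop_id mset.simps(2) mset_append union_mset_add_mset_right)
  ultimately show ?thesis
    using assms mset_eq_imp_distinct_iff[of "insert_entry v i \<beta>" "v # map (shift_from v) \<beta>"]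
      mset_eq_setD[of "insert_entry v i \<beta>" "v # map (shift_from v) \<beta>"]
    by (auto simp: permutations_of_set_def)
qed

lemma permutation_eq_insert_entry:
  assumes "xs @ v # ys \<in> permutations_of_set {1..Suc n}"
  obtains \<beta> where "\<beta> \<in> permutations_of_set {1..n}" "xs @ v # ys = insert_entry v (length xs) \<beta>"
proof -
  \<comment> \<open>\<open>g\<close> closes the gap at \<open>v\<close>; away from \<open>v\<close>
    it is undone by \<open>shift_from v\<close>.\<close>
  define g where "g = (\<lambda>x. if x < v then x else x - 1)"
  have s: "set (xs @ v # ys) = {1..Suc n}" "distinct (xs @ v # ys)"
    using assms by (auto simp: permutations_of_set_def)
  have v: "v \<in> {1..Suc n}" using s(1) by auto
  have sg: "shift_from v (g x) = x" if "x \<noteq> v" for x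
    using that v by (auto simp: shift_from_def g_def)
  have set: "set (xs @ ys) = {1..Suc n} - {v}" using s by auto
  have eq: "map (shift_from v) (map g zs) = zs" if "v \<notin> set zs" for zs
    using that by (induction zs) (auto simp: sg)
  have "inj_on g ({1..Suc n} - {v})" by (rule inj_on_inverseI[of _ "shift_from v"]) (simp add: sg)
  moreover have "g ` ({1..Suc n} - {v}) = {1..n}"
  proof
    show "{1..n} \<subseteq> g ` ({1..Suc n} - {v})"
    proof
      fix x assume "x \<in> {1..n}"
      then show "x \<in> g ` ({1..Suc n} - {v})"
        by (intro image_eqI[of _ _ "shift_from v x"]) (auto simp: g_def shift_from_def)
    qed
  qed (use v in \<open>auto simp: g_def\<close>)
  moreover have "distinct (xs @ ys)" using s(2) by simp
  ultimately have p: "map g (xs @ ys) \<in> permutations_of_set {1..n}"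
    unfolding permutations_of_set_def mem_Collect_eq distinct_map set_map set by blast
  have x: "xs = map (shift_from v) (take (length xs) (map g (xs @ ys)))"
    and y: "ys = map (shift_from v) (drop (length xs) (map g (xs @ ys)))"
    using s(2) eq[of xs] eq[of ys] by (auto simp del: map_map)
  show thesis
    by (rule that[OF p], unfold insert_entry_def take_map drop_map, use x y in simp)
qed

lemma inj_insert_entry: "inj_on (insert_entry v i) (permutations_of_set {1..n})"
proof (rule inj_onI)
  fix \<beta> \<gamma> assume a: "\<beta> \<in> permutations_of_set {1..n}" "\<gamma> \<in> permutations_of_set {1..n}"
    "insert_entry v i \<beta> = insert_entry v i \<gamma>"
  then have "length \<beta> = length \<gamma>" by (metis length_finite_permutations_of_set)
  with a(3) have "take i (map (shift_from v) \<beta>) = take i (map (shift_from v) \<gamma>)"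
    "drop i (map (shift_from v) \<beta>) = drop i (map (shift_from v) \<gamma>)"
    unfolding insert_entry_def by auto
  then have "map (shift_from v) \<beta> = map (shift_from v) \<gamma>" by (metis append_take_drop_id)
  then show "\<beta> = \<gamma>" using strict_mono_shift_from strict_mono_imp_inj_on inj_map_eq_map by metis
qed

lemma nth_insert_entry: "i \<le> length \<beta> \<Longrightarrow> insert_entry v i \<beta> ! i = v"
  by (simp add: insert_entry_def nth_append)

lemma sorted_map_shift_from [simp]: "sorted (map (shift_from v) xs) \<longleftrightarrow> sorted xs"
  using strict_mono_less_eq[OF strict_mono_shift_from] by (simp add: sorted_wrt_map)

section \<open>Avoiders with a prescribed beginning\<close>

definition split_at :: "nat \<Rightarrow> nat \<Rightarrow> nat list \<Rightarrow> bool" where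
  "split_at i l \<alpha> \<longleftrightarrow> sorted (take i \<alpha>) \<and> (\<forall>x\<in>set (take i \<alpha>). l < x) \<and> sorted (filter (\<lambda>x. x \<le> l) \<alpha>)"

lemma split_at_append:
  assumes "length xs = i"
  shows "split_at i l (xs @ ys) \<longleftrightarrow>
    sorted xs \<and> (\<forall>x\<in>set xs. l < x) \<and> sorted (filter (\<lambda>x. x \<le> l) ys)"
proof -
  have "filter (\<lambda>x. x \<le> l) xs = []" if "\<forall>x\<in>set xs. l < x"
    using that by (auto simp: filter_empty_conv)
  with assms show ?thesis by (auto simp: split_at_def)
qed

text \<open>On positive entries \<open>shift_from 1\<close> is \<open>Suc\<close>, so the threshold
  moves from \<open>l\<close> to \<open>Suc l\<close>; the new \<open>1\<close> stands before every
  other small entry because the first \<open>i\<close> entries are all large.\<close>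

lemma split_at_insert_min:
  assumes "i \<le> length \<beta>" "0 \<notin> set \<beta>"
  shows "split_at i (Suc l) (insert_entry 1 i \<beta>) \<longleftrightarrow> split_at i l \<beta>"
proof -
  let ?xs = "take i \<beta>" and ?ys = "drop i \<beta>"
  have "shift_from 1 x = Suc x" if "x \<in> set \<beta>" for x
    using that assms(2) by (auto simp: shift_from_def intro: gr0I)
  then have sh: "map (shift_from 1) \<beta> = map Suc \<beta>" by simp
  have len: "length (map Suc ?xs) = i" using assms(1) by simp
  have "filter (\<lambda>x. x \<le> Suc l) (map Suc ?ys) = map Suc (filter (\<lambda>x. x \<le> l) ?ys)"
    by (simp add: filter_map comp_def)
  then have "split_at i (Suc l) (insert_entry 1 i \<beta>) \<longleftrightarrow>
      sorted ?xs \<and> (\<forall>x\<in>set ?xs. l < x) \<and> sorted (filter (\<lambda>x. x \<le> l) ?ys)"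
    unfolding insert_entry_def sh take_map drop_map split_at_append[OF len]
    by (simp add: sorted_wrt_map)
  also have "\<dots> \<longleftrightarrow> split_at i l (?xs @ ?ys)"
    using assms(1) by (subst split_at_append) auto
  finally show ?thesis by simp
qed

text \<open>\<open>shift_from (Suc l)\<close> fixes the values up to \<open>l\<close> and lifts the
  others above \<open>Suc l\<close>: the small entries do not change, and the new entry is the least
  of the beginning.\<close>

lemma split_at_insert_front:
  "split_at (Suc i) l (insert_entry (Suc l) 0 \<beta>) \<longleftrightarrow> split_at i l \<beta>"
proof -
  let ?s = "shift_from (Suc l)"
  have le: "?s x \<le> l \<longleftrightarrow> x \<le> l" for x by (auto simp: shift_from_def)
  have gt: "l < ?s x \<longleftrightarrow> l < x" for x using le[of x] by linarith
  have filter: "filter (\<lambda>x. x \<le> l) (Suc l # map ?s \<beta>) = map ?s (filter (\<lambda>x. x \<le> l) \<beta>)"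
    by (simp add: filter_map comp_def le)
  have take: "take (Suc i) (Suc l # map ?s \<beta>) = Suc l # map ?s (take i \<beta>)"
    by (simp add: take_map)
  have "(\<forall>x\<in>set (Suc l # map ?s (take i \<beta>)). l < x) \<longleftrightarrow> (\<forall>x\<in>set (take i \<beta>). l < x)"
    by (simp add: gt)
  moreover have "sorted (Suc l # map ?s (take i \<beta>)) \<longleftrightarrow> sorted (take i \<beta>)"
    if "\<forall>x\<in>set (take i \<beta>). l < x"
    using that gt by (simp add: Suc_le_eq)
  ultimately show ?thesis
    unfolding split_at_def insert_entry_def take_0 drop_0 append_Nil take filter sorted_map_shift_from
    by blast
qed

lemma sorted_filter_permutation:
  assumes "\<alpha> \<in> permutations_of_set {1..n}" "l \<le> n" "sorted (filter (\<lambda>x. x \<le> l) \<alpha>)"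
  shows "filter (\<lambda>x. x \<le> l) \<alpha> = [1..<Suc l]"
  using assms
  by (intro sorted_distinct_set_unique) (auto simp: permutations_of_set_def simp del: upt_Suc)

section \<open>The two long patterns and the avoiders with a prescribed beginning\<close>

locale pattern_X2 =
  fixes k d :: nat
  assumes d_ge_2: "2 \<le> d" and d_le: "d + 2 \<le> k"
begin

text \<open>The long patterns differ only in the order of the adjacent entries \<open>1\<close> and
  \<open>k\<close>, so their \<open>1\<close> stands at index \<open>k - d - 1\<close> in
  \<open>patA\<close> and at index \<open>k - d\<close> in \<open>patB\<close>.\<close>

definition patA where "patA = [d + 1..<k] @ [1, k] @ [2..<d + 1]"
definition patB where "patB = [d + 1..<k + 1] @ [1..<d + 1]"

lemma length_patA: "length patA = k" and length_patB: "length patB = k"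
  using d_ge_2 d_le by (auto simp: patA_def patB_def)

lemma patA_split: "patA = [d + 1..<k] @ 1 # k # [2..<d + 1]"
  by (simp add: patA_def)

lemma patB_split: "patB = [d + 1..<k + 1] @ 1 # [2..<d + 1]"
  using d_ge_2 by (auto simp: patB_def upt_conv_Cons numeral_2_eq_2)

lemma nth_patA_min: "patA ! (k - d - 1) = 1" and nth_patA_max: "patA ! (k - d) = k"
  using d_ge_2 d_le by (auto simp: patA_split nth_append nth_Cons' simp del: upt_Suc)

lemma nth_patB_min: "patB ! (k - d) = 1"
  using d_ge_2 d_le by (auto simp: patB_split nth_append simp del: upt_Suc)

lemma nth_pat_0: "patA ! 0 = d + 1" "patB ! 0 = d + 1"
  using d_ge_2 d_le by (auto simp: patA_def patB_def nth_append simp del: upt_Suc)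

lemma set_patA: "set patA = {1..k}" and set_patB: "set patB = {1..k}"
  using d_ge_2 d_le by (auto simp: patA_def patB_def)

lemma pat_ge_1: "b < k \<Longrightarrow> 1 \<le> patA ! b" "b < k \<Longrightarrow> 1 \<le> patB ! b"
  using nth_mem[of b patA] nth_mem[of b patB]
  by (auto simp: set_patA set_patB length_patA length_patB)

definition av :: "nat \<Rightarrow> nat list set" where "av n = avoiders (patterns_X2 k d) n"

lemma av_iff: "\<alpha> \<in> av n \<longleftrightarrow> \<alpha> \<in> permutations_of_set {1..n} \<and> \<not> contains_pattern \<alpha> [3, 2, 1] \<and>
   \<not> contains_pattern \<alpha> patA \<and> \<not> contains_pattern \<alpha> patB"
  unfolding av_def avoiders_def patterns_X2_def patA_def[symmetric] patB_def[symmetric] by blast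

text \<open>The set counted by f(i, l; n).\<close>

definition avs :: "nat \<Rightarrow> nat \<Rightarrow> nat \<Rightarrow> nat list set" where
  "avs i l n = {\<alpha> \<in> av n. split_at i l \<alpha>}"

lemma finite_avs [simp]: "finite (avs i l n)"
  unfolding avs_def av_def avoiders_def by simp

lemma av_no_321: "\<alpha> \<in> av n \<Longrightarrow> subseq [x, y, z] \<alpha> \<Longrightarrow> z < y \<Longrightarrow> y < x \<Longrightarrow> False"
  unfolding av_iff contains_321_iff by blast

section \<open>Inserting a new minimum after the first entries\<close>

lemma av_insert_entryD:
  assumes "insert_entry v i \<beta> \<in> av (Suc n)" "\<beta> \<in> permutations_of_set {1..n}"
  shows "\<beta> \<in> av n"
  using assms contains_insert_entry by (auto simp: av_iff)

text \<open>A new occurrence uses the inserted \<open>1\<close>, which must play the minimum of the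
  pattern, at index \<open>j\<close>. So \<open>j\<close> entries of the occurrence come from the
  first \<open>i\<close> entries; the conclusion \<open>j \<le> i\<close> is what excludes the long
  patterns for small \<open>i\<close>.\<close>

lemma contains_insert_minE:
  assumes "contains_pattern (insert_entry 1 i \<beta>) \<tau>" "\<not> contains_pattern \<beta> \<tau>" "0 \<notin> set \<beta>"
    and "j < length \<tau>" "\<forall>b<length \<tau>. \<tau> ! j \<le> \<tau> ! b"
  obtains b1 b2 where "subseq b1 (take i (map (shift_from 1) \<beta>))"
    "subseq b2 (drop i (map (shift_from 1) \<beta>))" "order_iso (b1 @ 1 # b2) \<tau>"
    "length b1 = j" "j \<le> i" "\<forall>x\<in>set b1 \<union> set b2. 1 < x"
proof -
  obtain b1 b2 where b: "subseq b1 (take i (map (shift_from 1) \<beta>))"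
    "subseq b2 (drop i (map (shift_from 1) \<beta>))" "order_iso (b1 @ 1 # b2) \<tau>"
    using contains_insert_entryE[OF assms(1,2)] .
  have "set b1 \<union> set b2 \<subseteq> shift_from 1 ` set \<beta>"
    using subseq_set_subset[OF b(1)] subseq_set_subset[OF b(2)]
      set_take_subset[of i "map (shift_from 1) \<beta>"] set_drop_subset[of i "map (shift_from 1) \<beta>"]
    unfolding set_map by blast
  then have gt: "\<forall>x\<in>set b1 \<union> set b2. 1 < x"
  proof (intro ballI)
    fix x assume "x \<in> set b1 \<union> set b2"
    with \<open>set b1 \<union> set b2 \<subseteq> shift_from 1 ` set \<beta>\<close> obtain y where "y \<in> set \<beta>" "x = shift_from 1 y"
      by blast
    moreover have "y \<noteq> 0" using calculation assms(3) by metis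
    ultimately show "1 < x" by simp
  qed
  then have "length b1 = j" using b(3) assms(4,5) by (intro order_iso_min_index)
  moreover have "length b1 \<le> i" using list_emb_length[OF b(1)] by simp
  ultimately show thesis using that b gt by blast
qed

lemma insert_min_avoids_321:
  assumes "\<not> contains_pattern \<beta> [3, 2, 1]" "0 \<notin> set \<beta>" "sorted (take i \<beta>)"
  shows "\<not> contains_pattern (insert_entry 1 i \<beta>) [3, 2, 1]"
proof
  assume "contains_pattern (insert_entry 1 i \<beta>) [3, 2, 1]"
  then obtain b1 b2 where b: "subseq b1 (take i (map (shift_from 1) \<beta>))"
    "order_iso (b1 @ 1 # b2) [3, 2, 1]" "length b1 = 2"
    \<comment> \<open>The minimum of \<open>[3, 2, 1]\<close> is at index 2, so a new occurrence
      needs a descent among the first \<open>i\<close> entries, which are sorted.\<close>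
    using assms(1,2) by (rule contains_insert_minE[of _ _ _ 2])
      (auto simp: nth_Cons numeral_3_eq_3 numeral_2_eq_2 split: nat.splits)
  from b(3) obtain x y where xy: "b1 = [x, y]" by (auto simp: length_Suc_conv numeral_2_eq_2)
  have "sorted b1" using sorted_subseq[OF b(1)] assms(3) by (simp add: take_map)
  then have "x \<le> y" using xy by simp
  moreover have "y < x" using b(2) unfolding xy order_iso_def by (force simp: numeral_3_eq_3)
  ultimately show False by simp
qed

text \<open>The \<open>1\<close> of \<open>patB\<close> has \<open>k - d\<close> entries before it,
  more than the \<open>i\<close> that are available.\<close>

lemma insert_min_avoids_patB:
  assumes "\<not> contains_pattern \<beta> patB" "0 \<notin> set \<beta>" "i < k - d"
  shows "\<not> contains_pattern (insert_entry 1 i \<beta>) patB"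
proof
  assume "contains_pattern (insert_entry 1 i \<beta>) patB"
  then show False using assms(1,2)
    by (rule contains_insert_minE[of _ _ _ "k - d"])
      (use assms(3) d_ge_2 d_le in \<open>auto simp: length_patB nth_patB_min pat_ge_1 simp del: One_nat_def\<close>)
qed

lemma insert_min_avoids_patA:
  assumes "\<not> contains_pattern \<beta> patA" "0 \<notin> set \<beta>" "i < k - d - 1"
  shows "\<not> contains_pattern (insert_entry 1 i \<beta>) patA"
proof
  assume "contains_pattern (insert_entry 1 i \<beta>) patA"
  then show False using assms(1,2)
    by (rule contains_insert_minE[of _ _ _ "k - d - 1"])
      (use assms(3) d_ge_2 d_le in \<open>auto simp: length_patA nth_patA_min[simplified] pat_ge_1[simplified]\<close>)
qed

section \<open>Inserting a new first entry\<close>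

lemma order_iso_nth_0_rank:
  assumes "order_iso (v # b) \<tau>" "distinct b" "set \<tau> = {1..k}" "length \<tau> = k" "\<tau> ! 0 = d + 1"
  shows "d \<le> card {x \<in> set b. x < v}"
proof -
  have "\<exists>a<k. \<tau> ! a = t" if "t \<in> {1..k}" for t
    using that assms(3,4) by (metis in_set_conv_nth)
  \<comment> \<open>\<open>p\<close> locates the values of the pattern. The values
    \<open>1..d\<close> lie below its first entry \<open>d + 1\<close>, so the entries at
    \<open>p 1, ..., p d\<close> of the occurrence are \<open>d\<close> different values below
    \<open>v\<close>.\<close>
  then obtain p where p: "\<And>t. t \<in> {1..k} \<Longrightarrow> p t < k \<and> \<tau> ! (p t) = t" by metis
  have len: "length (v # b) = k" using assms(1,4) by (simp add: order_iso_def)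
  have k: "0 < k" using d_le by simp
  have lt: "(v # b) ! p t < v" if "t \<in> {1..d}" for t
  proof -
    have "\<tau> ! p t < \<tau> ! 0" using p[of t] that d_le assms(5) by simp
    then have "(v # b) ! p t < (v # b) ! 0"
      using order_isoD[OF assms(1), of "p t" 0] assms(4) p[of t] that d_le by simp
    then show ?thesis by simp
  qed
  have "inj_on (\<lambda>t. (v # b) ! p t) {1..d}"
  proof (rule inj_onI)
    fix s t assume st: "s \<in> {1..d}" "t \<in> {1..d}" "(v # b) ! p s = (v # b) ! p t"
    have "\<not> \<tau> ! p s < \<tau> ! p t" "\<not> \<tau> ! p t < \<tau> ! p s"
      using assms(1,4) p[of s] p[of t] st d_le unfolding order_iso_def by (metis atLeastAtMost_iff add_leD1 le_trans less_irrefl)+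
    then show "s = t" using p[of s] p[of t] st d_le by auto
  qed
  moreover have "(\<lambda>t. (v # b) ! p t) ` {1..d} \<subseteq> {x \<in> set b. x < v}"
  proof
    fix x assume "x \<in> (\<lambda>t. (v # b) ! p t) ` {1..d}"
    then obtain t where t: "t \<in> {1..d}" "x = (v # b) ! p t" by blast
    then have "x \<in> set (v # b)" using p[of t] len d_le by (metis atLeastAtMost_iff add_leD1 le_trans nth_mem)
    then show "x \<in> {x \<in> set b. x < v}" using lt[OF t(1)] t(2) by auto
  qed
  ultimately have "card {1..d} \<le> card {x \<in> set b. x < v}" by (intro card_inj_on_le) auto
  then show ?thesis by simp
qed

text \<open>A new occurrence starts with the inserted \<open>Suc l\<close>, as nothing precedes it.
  The pattern starts with \<open>d + 1\<close> and so demands \<open>d\<close> smaller entries after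
  it, but only the \<open>l < d\<close> positive values up to \<open>l\<close> are smaller.\<close>

lemma insert_front_avoids:
  assumes "\<not> contains_pattern \<beta> \<tau>" "0 \<notin> set \<beta>" "distinct \<beta>" "l < d"
    and "set \<tau> = {1..k}" "length \<tau> = k" "\<tau> ! 0 = d + 1"
  shows "\<not> contains_pattern (insert_entry (Suc l) 0 \<beta>) \<tau>"
proof
  assume "contains_pattern (insert_entry (Suc l) 0 \<beta>) \<tau>"
  then obtain b1 b where b1: "subseq b1 (take 0 (map (shift_from (Suc l)) \<beta>))"
    and b: "subseq b (drop 0 (map (shift_from (Suc l)) \<beta>))" and iso: "order_iso (b1 @ Suc l # b) \<tau>"
    using assms(1) by (rule contains_insert_entryE)
  have "b1 = []" using b1 by (simp add: list_emb_Nil2)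
  have sub: "subseq b (map (shift_from (Suc l)) \<beta>)" using b by simp
  have "distinct (map (shift_from (Suc l)) \<beta>)" 
    using assms(3) strict_mono_shift_from strict_mono_imp_inj_on by (auto simp: distinct_map)
  then have "distinct b" using sub subseq_conv_nths distinct_nthsI by metis
  with iso \<open>b1 = []\<close> assms have "d \<le> card {x \<in> set b. x < Suc l}"
    by (intro order_iso_nth_0_rank) auto
  also have "\<dots> \<le> card {1..l}"
  proof (intro card_mono subsetI)
    fix x assume x: "x \<in> {x \<in> set b. x < Suc l}"
    then obtain y where "y \<in> set \<beta>" "x = shift_from (Suc l) y"
      using subseq_set_subset[OF sub] by auto
    then have "0 < x" using assms(2) by (cases "y = 0") (auto simp: shift_from_def)
    with x show "x \<in> {1..l}" by simp
  qed simp
  finally show False using assms(4) by simp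
qed

text \<open>In a new occurrence \<open>Suc l\<close> plays the \<open>3\<close>; the other two
  entries form a descent among the values up to \<open>l\<close>, which appear in increasing
  order.\<close>

lemma insert_front_avoids_321:
  assumes "\<not> contains_pattern \<beta> [3, 2, 1]" "sorted (filter (\<lambda>x. x \<le> l) \<beta>)"
  shows "\<not> contains_pattern (insert_entry (Suc l) 0 \<beta>) [3, 2, 1]"
proof
  assume "contains_pattern (insert_entry (Suc l) 0 \<beta>) [3, 2, 1]"
  then obtain b1 b where b1: "subseq b1 (take 0 (map (shift_from (Suc l)) \<beta>))"
    and b: "subseq b (drop 0 (map (shift_from (Suc l)) \<beta>))" and iso: "order_iso (b1 @ Suc l # b) [3, 2, 1]"
    using assms(1) by (rule contains_insert_entryE)
  have b1: "b1 = []" using b1 by (simp add: list_emb_Nil2)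
  then obtain x y where xy: "b = [x, y]" using iso by (auto simp: order_iso_def length_Suc_conv)
  have lt: "y < x" "x < Suc l" using iso unfolding b1 xy order_iso_def by (force simp: numeral_3_eq_3)+
  from b obtain c where c: "b = map (shift_from (Suc l)) c" "subseq c \<beta>" 
    by (auto simp: subseq_conv_nths nths_map)
  with xy lt have "c = [x, y]" by (auto simp: shift_from_def split: if_splits)
  with c(2) have "subseq (filter (\<lambda>x. x \<le> l) [x, y]) (filter (\<lambda>x. x \<le> l) \<beta>)" by (metis subseq_filter)
  then have "subseq [x, y] (filter (\<lambda>x. x \<le> l) \<beta>)" using lt by simp
  from sorted_subseq[OF this assms(2)] have "x \<le> y" by simp
  with lt show False by simp
qed

section \<open>The two recursions away from the corner\<close>

lemma avs_length: "\<alpha> \<in> avs i l n \<Longrightarrow> length \<alpha> = n"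
  unfolding avs_def av_def avoiders_def
  using length_finite_permutations_of_set[of \<alpha> "{1..n}"] by auto

lemma avs_permutation: "\<alpha> \<in> avs i l n \<Longrightarrow> \<alpha> \<in> permutations_of_set {1..n}"
  unfolding avs_def by (simp add: av_iff)

lemma avs_zero_notin: "\<alpha> \<in> avs i l n \<Longrightarrow> 0 \<notin> set \<alpha>"
  using avs_permutation[of \<alpha> i l n] by (auto simp: permutations_of_set_def)

text \<open>The case distinction is on the entry \<open>a\<close> at index \<open>i\<close>: a large
  \<open>a\<close> extends the increasing beginning because 321 is avoided, and a small
  \<open>a\<close> must be \<open>1\<close> and can be deleted.\<close>

lemma avs_next_entry:
  assumes \<alpha>: "\<alpha> \<in> avs i (Suc l) (Suc n)" and i: "i \<le> n" and l: "l \<le> n"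
  shows "\<alpha> \<in> avs (Suc i) (Suc l) (Suc n) \<or> \<alpha> \<in> insert_entry 1 i ` avs i l n"
proof -
  have av: "\<alpha> \<in> av (Suc n)" using \<alpha> by (simp add: avs_def)
  have perm: "\<alpha> \<in> permutations_of_set {1..Suc n}" using \<alpha> by (rule avs_permutation)
  define xs a ys where "xs = take i \<alpha>" and "a = \<alpha> ! i" and "ys = drop (Suc i) \<alpha>"
  have eq: "\<alpha> = xs @ a # ys" and len: "length xs = i"
    using avs_length[OF \<alpha>] i id_take_nth_drop[of i \<alpha>] by (auto simp: xs_def a_def ys_def)
  have split: "split_at i (Suc l) (xs @ a # ys)" using \<alpha> eq by (simp add: avs_def)
  then have xs: "sorted xs" "\<forall>x\<in>set xs. Suc l < x"
    and low: "sorted (filter (\<lambda>x. x \<le> Suc l) (a # ys))"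
    unfolding split_at_append[OF len] by blast+
  show ?thesis
  proof (cases "a \<le> Suc l")
    case False
    have "1 \<in> set \<alpha>" using perm by (simp add: permutations_of_set_def)
    then have "1 \<in> set ys" using xs(2) False unfolding eq by force
    \<comment> \<open>The value \<open>1\<close> comes after \<open>a\<close>, so an earlier entry
      above \<open>a\<close> would complete a 321.\<close>
    then have "subseq [x, a, 1] \<alpha>" if "x \<in> set xs" for x
      using list_emb_append_mono[of "(=)" "[x]" xs "[a, 1]" "a # ys"] that
      unfolding eq by (simp add: subseq_singleton_left)
    then have "x \<le> a" if "x \<in> set xs" for x
      using av_no_321[OF av, of x a 1] that False by force
    then have "split_at (Suc i) (Suc l) ((xs @ [a]) @ ys)"
      using xs low False len by (subst split_at_append) (auto simp: sorted_append)
    then show ?thesis using av eq by (simp add: avs_def)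
  next
    case True
    \<comment> \<open>The small values occur in the order \<open>1, 2, ...\<close> and none of them
      is in \<open>xs\<close>, so the small entry \<open>a\<close> is the first of them.\<close>
    have "filter (\<lambda>x. x \<le> Suc l) \<alpha> = [1..<Suc (Suc l)]"
      using perm l \<alpha> by (intro sorted_filter_permutation[of _ "Suc n"]) (auto simp: avs_def split_at_def)
    moreover have "filter (\<lambda>x. x \<le> Suc l) xs = []"
      using xs(2) by (force simp: filter_empty_conv)
    ultimately have "a # filter (\<lambda>x. x \<le> Suc l) ys = [1..<Suc (Suc l)]"
      using True unfolding eq by simp
    also have "[1..<Suc (Suc l)] = 1 # [2..<Suc (Suc l)]" 
      by (subst upt_conv_Cons) (auto simp: numeral_2_eq_2)
    finally have "a = 1" by simp
    then obtain \<beta> where \<beta>: "\<beta> \<in> permutations_of_set {1..n}" "\<alpha> = insert_entry 1 i \<beta>"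
      using permutation_eq_insert_entry[of xs 1 ys n] perm eq len by metis
    have "i \<le> length \<beta>" "0 \<notin> set \<beta>"
      using \<beta>(1) i length_finite_permutations_of_set[OF \<beta>(1)] by (auto simp: permutations_of_set_def)
    then have "split_at i l \<beta>" using \<alpha> \<beta>(2) split_at_insert_min by (simp add: avs_def)
    then have "\<beta> \<in> avs i l n" using av_insert_entryD[of 1 i \<beta> n] av \<beta> by (simp add: avs_def)
    then show ?thesis using \<beta>(2) by blast
  qed
qed

lemma avs_Suc_subset: "avs (Suc i) l n \<subseteq> avs i l n"
proof
  fix \<alpha> assume "\<alpha> \<in> avs (Suc i) l n"
  moreover have "take i \<alpha> = take i (take (Suc i) \<alpha>)" by simp
  ultimately show "\<alpha> \<in> avs i l n"
    unfolding avs_def split_at_def by (auto simp del: take_take dest: in_set_takeD intro: sorted_wrt_take)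
qed

lemma avs_nth_gt:
  assumes "\<alpha> \<in> avs (Suc i) l n" "i < n"
  shows "l < \<alpha> ! i"
proof -
  have "i < length (take (Suc i) \<alpha>)" using assms avs_length by simp
  from nth_mem[OF this] have "\<alpha> ! i \<in> set (take (Suc i) \<alpha>)" by simp
  then show ?thesis using assms(1) by (simp add: avs_def split_at_def)
qed

lemma insert_min_avs:
  assumes "\<beta> \<in> avs i l n" "i \<le> n" "insert_entry 1 i \<beta> \<in> av (Suc n)"
  shows "insert_entry 1 i \<beta> \<in> avs i (Suc l) (Suc n)"
  using assms split_at_insert_min[of i \<beta> l] avs_length[OF assms(1)] avs_zero_notin[OF assms(1)]
  by (simp add: avs_def)

lemma card_insert_entry_image:
  assumes "B \<subseteq> avs i l n"
  shows "card (insert_entry v j ` B) = card B"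
proof (rule card_image)
  have "B \<subseteq> permutations_of_set {1..n}" using assms avs_permutation by blast
  then show "inj_on (insert_entry v j) B" by (rule inj_on_subset[OF inj_insert_entry])
qed

text \<open>The bound on \<open>i\<close> leaves too few entries before an inserted \<open>1\<close>
  to create a long pattern, so both alternatives of \<open>avs_next_entry\<close> occur in full.
  They are disjoint: the entry at index \<open>i\<close> exceeds \<open>Suc l\<close> in one and
  equals \<open>1\<close> in the other.\<close>

lemma card_avs_next_entry:
  assumes "i \<le> n" "l \<le> n" "i < k - d - 1"
  shows "card (avs i (Suc l) (Suc n)) = card (avs (Suc i) (Suc l) (Suc n)) + card (avs i l n)"
proof -
  have "insert_entry 1 i \<beta> \<in> avs i (Suc l) (Suc n)" if \<beta>: "\<beta> \<in> avs i l n" for \<beta>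
  proof (rule insert_min_avs[OF \<beta> assms(1)])
    have "\<beta> \<in> av n" "sorted (take i \<beta>)" "0 \<notin> set \<beta>" "\<beta> \<in> permutations_of_set {1..n}"
      using \<beta> avs_zero_notin avs_permutation by (auto simp: avs_def split_at_def)
    then show "insert_entry 1 i \<beta> \<in> av (Suc n)"
      using insert_entry_permutation[of \<beta> n 1 i] insert_min_avoids_321[of \<beta> i]
        insert_min_avoids_patA[of \<beta> i] insert_min_avoids_patB[of \<beta> i] assms(3)
      unfolding av_iff by simp
  qed
  then have "avs i (Suc l) (Suc n) = avs (Suc i) (Suc l) (Suc n) \<union> insert_entry 1 i ` avs i l n"
    using avs_next_entry[OF _ assms(1,2)] avs_Suc_subset by blast
  moreover have "avs (Suc i) (Suc l) (Suc n) \<inter> insert_entry 1 i ` avs i l n = {}"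
    using avs_nth_gt[of _ i "Suc l" "Suc n"] assms(1) avs_length nth_insert_entry[of i _ 1] by fastforce
  ultimately show ?thesis
    using card_insert_entry_image[OF order_refl] by (simp add: card_Un_disjoint)
qed

text \<open>The first entry \<open>a\<close> is the least of the beginning. If it is
  \<open>Suc l\<close>, it can be deleted. Otherwise the whole beginning exceeds
  \<open>Suc l\<close>, and a descent among the values up to \<open>Suc l\<close> would form a 321
  together with \<open>a\<close>.\<close>

lemma avs_next_value:
  assumes \<alpha>: "\<alpha> \<in> avs (Suc i) l (Suc n)"
  shows "\<alpha> \<in> avs (Suc i) (Suc l) (Suc n) \<or> \<alpha> \<in> insert_entry (Suc l) 0 ` avs i l n"
proof -
  have av: "\<alpha> \<in> av (Suc n)" using \<alpha> by (simp add: avs_def)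
  have perm: "\<alpha> \<in> permutations_of_set {1..Suc n}" using \<alpha> by (rule avs_permutation)
  obtain a ys where eq: "\<alpha> = a # ys" using avs_length[OF \<alpha>] by (cases \<alpha>) auto
  have split: "split_at (Suc i) l (a # ys)" using \<alpha> eq by (simp add: avs_def)
  then have s: "sorted (a # take i ys)" "\<forall>x\<in>set (a # take i ys). l < x"
    by (simp_all add: split_at_def)
  show ?thesis
  proof (cases "a = Suc l")
    case True
    then obtain \<beta> where \<beta>: "\<beta> \<in> permutations_of_set {1..n}" "\<alpha> = insert_entry (Suc l) 0 \<beta>"
      using permutation_eq_insert_entry[of "[]" "Suc l" ys n] perm eq by auto
    then have "split_at i l \<beta>" using \<alpha> split_at_insert_front by (simp add: avs_def)
    then have "\<beta> \<in> avs i l n" using av_insert_entryD[of "Suc l" 0 \<beta> n] av \<beta> by (simp add: avs_def)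
    then show ?thesis using \<beta>(2) by blast
  next
    case False
    then have gt: "Suc l < a" using s(2) by auto
    have "sorted (filter (\<lambda>x. x \<le> Suc l) \<alpha>)"
    proof (rule ccontr)
      assume "\<not> ?thesis"
      then obtain x y where xy: "subseq [x, y] (filter (\<lambda>x. x \<le> Suc l) ys)" "y < x"
        using not_sorted_subseq[of "filter (\<lambda>x. x \<le> Suc l) \<alpha>"] gt eq by auto
      then have "x \<le> Suc l" using subseq_set_subset[OF xy(1)] by auto
      moreover have "subseq [a, x, y] \<alpha>"
        using subseq_order.order_trans[OF xy(1) subseq_filter_self] unfolding eq by simp
      ultimately show False using av_no_321[OF av] xy(2) gt by force
    qed
    then have "split_at (Suc i) (Suc l) \<alpha>"
      using s gt unfolding split_at_def eq by auto
    then show ?thesis using av by (simp add: avs_def)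
  qed
qed

lemma avs_value_subset: "avs i (Suc l) n \<subseteq> avs i l n"
proof
  fix \<alpha> assume "\<alpha> \<in> avs i (Suc l) n"
  moreover have "filter (\<lambda>x. x \<le> l) \<alpha> = filter (\<lambda>x. x \<le> l) (filter (\<lambda>x. x \<le> Suc l) \<alpha>)"
    by (auto intro: filter_cong)
  ultimately show "\<alpha> \<in> avs i l n"
    unfolding avs_def split_at_def by (auto simp del: filter_filter simp: sorted_wrt_filter)
qed

text \<open>For \<open>l < d\<close> putting \<open>Suc l\<close> in front creates no forbidden
  pattern, and the two alternatives of \<open>avs_next_value\<close> are told apart by whether the
  first entry is \<open>Suc l\<close>.\<close>

lemma card_avs_next_value:
  assumes "l < d" "l \<le> n"
  shows "card (avs (Suc i) l (Suc n)) = card (avs (Suc i) (Suc l) (Suc n)) + card (avs i l n)"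
proof -
  have "insert_entry (Suc l) 0 \<beta> \<in> avs (Suc i) l (Suc n)" if \<beta>: "\<beta> \<in> avs i l n" for \<beta>
  proof -
    have "\<beta> \<in> av n" "sorted (filter (\<lambda>x. x \<le> l) \<beta>)" "0 \<notin> set \<beta>" "\<beta> \<in> permutations_of_set {1..n}"
      using \<beta> avs_zero_notin avs_permutation by (auto simp: avs_def split_at_def)
    moreover from this(4) have "distinct \<beta>" by (simp add: permutations_of_set_def)
    ultimately have "insert_entry (Suc l) 0 \<beta> \<in> av (Suc n)"
      using insert_entry_permutation[of \<beta> n "Suc l" 0] insert_front_avoids_321[of \<beta> l] assms
        insert_front_avoids[of \<beta> patA l] insert_front_avoids[of \<beta> patB l]
        set_patA set_patB length_patA length_patB nth_pat_0
      unfolding av_iff by simp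
    then show ?thesis using \<beta> split_at_insert_front by (simp add: avs_def)
  qed
  then have "avs (Suc i) l (Suc n) = avs (Suc i) (Suc l) (Suc n) \<union> insert_entry (Suc l) 0 ` avs i l n"
    using avs_next_value[of _ i l n] avs_value_subset[of "Suc i" l "Suc n"] by blast
  moreover have "avs (Suc i) (Suc l) (Suc n) \<inter> insert_entry (Suc l) 0 ` avs i l n = {}"
    by (auto simp: avs_def split_at_def insert_entry_def)
  ultimately show ?thesis
    using card_insert_entry_image[OF order_refl] by (simp add: card_Un_disjoint)
qed

section \<open>The corner, where the long patterns take effect\<close>

definition embed :: "nat list \<Rightarrow> nat \<Rightarrow> nat" where
  "embed zs x = (if x \<le> d then x else zs ! (x - d - 1))"

text \<open>\<open>embed zs\<close> keeps the values \<open>1..d\<close> and sends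
  \<open>d + 1, ..., k\<close> to \<open>zs\<close> in order, so it is increasing; it turns a long
  pattern into an explicit occurrence with high entries \<open>zs\<close>.\<close>

lemma order_iso_embed:
  assumes "sorted zs" "distinct zs" "length zs = k - d" "\<forall>x\<in>set zs. d < x" "set \<tau> = {1..k}"
  shows "order_iso (map (embed zs) \<tau>) \<tau>"
proof (rule order_iso_map)
  have "zs ! a < zs ! b" if "a < b" "b < length zs" for a b
    using assms(1,2) that by (metis sorted_wrt_nth_less strict_sorted_iff)
  moreover have "d < zs ! a" if "a < length zs" for a
    using assms(4) that by simp
  ultimately show "strict_mono_on (set \<tau>) (embed zs)"
    using assms(3) unfolding assms(5) by (auto simp: strict_mono_on_def embed_def intro: le_less_trans)
qed

lemma map_embed_low: "b \<le> Suc d \<Longrightarrow> map (embed zs) [a..<b] = [a..<b]"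
  by (auto simp: embed_def intro!: map_idI)

lemma map_embed_high:
  assumes "length zs = k - d"
  shows "map (embed zs) [d + 1..<k + 1] = zs"
  using assms d_le by (intro nth_equalityI) (auto simp: embed_def simp del: upt_Suc)

lemma avs_low_entries:
  assumes "\<alpha> \<in> avs i l n" "l \<le> n"
  shows "filter (\<lambda>x. x \<le> l) \<alpha> = [1..<Suc l]"
  using assms avs_permutation by (intro sorted_filter_permutation[of _ n]) (auto simp: avs_def split_at_def)

text \<open>The \<open>k - d\<close> increasing entries above \<open>d\<close>, followed by
  \<open>1, ..., d\<close> in this order, would be an occurrence of \<open>patB\<close>.\<close>

lemma avs_empty:
  assumes "k - d \<le> n" "d \<le> n"
  shows "avs (k - d) d n = {}"
proof (rule equals0I)
  fix \<alpha> assume \<alpha>: "\<alpha> \<in> avs (k - d) d n"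
  define zs ys where "zs = take (k - d) \<alpha>" and "ys = drop (k - d) \<alpha>"
  have eq: "\<alpha> = zs @ ys" by (simp add: zs_def ys_def)
  have zs: "length zs = k - d" "sorted zs" "\<forall>x\<in>set zs. d < x"
    using \<alpha> avs_length[OF \<alpha>] assms by (auto simp: zs_def avs_def split_at_def)
  have "distinct \<alpha>" using avs_permutation[OF \<alpha>] by (simp add: permutations_of_set_def)
  then have "order_iso (map (embed zs) patB) patB"
    using zs eq set_patB by (intro order_iso_embed) auto
  moreover have "map (embed zs) patB = zs @ [1..<Suc d]"
    unfolding patB_def map_append map_embed_high[OF zs(1)] using map_embed_low[of "d + 1" zs 1] by simp
  moreover have "filter (\<lambda>x. x \<le> d) zs = []" using zs(3) by (force simp: filter_empty_conv)
  then have "[1..<Suc d] = filter (\<lambda>x. x \<le> d) ys"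
    using avs_low_entries[OF \<alpha> assms(2)] unfolding eq by simp
  then have "subseq (zs @ [1..<Suc d]) \<alpha>"
    unfolding eq using subseq_filter_self[of _ ys] by (auto intro: list_emb_append_mono)
  ultimately have "contains_pattern \<alpha> patB" unfolding contains_pattern_iff_subseq by metis
  then show False using \<alpha> by (simp add: avs_def av_iff)
qed

text \<open>If the entry \<open>c\<close> after the inserted \<open>1\<close> continued the
  increasing beginning \<open>xs\<close>, then \<open>xs\<close>, \<open>1\<close>,
  \<open>c\<close>, \<open>2, ..., d\<close> would be an occurrence of \<open>patA\<close> in which
  \<open>c\<close> plays \<open>k\<close>.\<close>

lemma avs_max_second_low:
  assumes \<alpha>: "insert_entry 1 (k - d - 1) \<beta> \<in> avs (k - d - 1) d (Suc n)"
    and \<beta>: "\<beta> \<in> avs (k - d) (d - 1) n" and n: "k - 1 \<le> n"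
  shows False
proof -
  let ?i = "k - d - 1" and ?\<gamma> = "map (shift_from 1) \<beta>"
  define xs c ys where "xs = take ?i ?\<gamma>" and "c = ?\<gamma> ! ?i" and "ys = drop (Suc ?i) ?\<gamma>"
  have len: "length \<beta> = n" using \<beta> by (rule avs_length)
  have i: "?i < n" "Suc ?i = k - d" using n d_le d_ge_2 by auto
  have il: "?i < length ?\<gamma>" using i len by simp
  have eq: "insert_entry 1 ?i \<beta> = xs @ 1 # c # ys"
    using Cons_nth_drop_Suc[OF il] by (simp only: insert_entry_def xs_def c_def ys_def)
  have zs: "xs @ [c] = take (k - d) ?\<gamma>"
    using take_Suc_conv_app_nth[OF il] by (simp only: xs_def c_def i(2))
  have "length (xs @ [c]) = k - d" "sorted (xs @ [c])"
    using \<beta> len i unfolding zs by (auto simp: avs_def split_at_def take_map)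
  moreover have gt: "\<forall>x\<in>set (xs @ [c]). d < x"
    using \<beta> unfolding zs take_map by (force simp: avs_def split_at_def shift_from_def)
  moreover have "distinct (insert_entry 1 ?i \<beta>)"
    using avs_permutation[OF \<alpha>] by (simp add: permutations_of_set_def)
  then have "distinct (xs @ [c])" unfolding eq by simp
  ultimately have iso: "order_iso (map (embed (xs @ [c])) patA) patA"
    by (intro order_iso_embed set_patA)
  have "map (embed (xs @ [c])) ([d + 1..<k] @ [k]) = xs @ [c]"
    using map_embed_high[of "xs @ [c]"] \<open>length (xs @ [c]) = k - d\<close> d_le by simp
  then have "map (embed (xs @ [c])) patA = xs @ 1 # c # [2..<Suc d]"
    using map_embed_low[of "Suc d" "xs @ [c]" 2] d_ge_2 unfolding patA_def
    by (simp add: embed_def del: upt_Suc)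
  moreover have "subseq (xs @ 1 # c # [2..<Suc d]) (insert_entry 1 ?i \<beta>)"
  proof -
    have "d \<le> Suc n" using n d_le by simp
    from avs_low_entries[OF \<alpha> this] gt have "1 # filter (\<lambda>x. x \<le> d) ys = [1..<Suc d]"
      unfolding eq using d_ge_2 by (auto simp: filter_empty_conv not_le simp del: upt_Suc)
    also have "\<dots> = 1 # [2..<Suc d]" by (subst upt_conv_Cons) (use d_ge_2 in \<open>auto simp: numeral_2_eq_2\<close>)
    finally have "subseq [2..<Suc d] ys" using subseq_filter_self[of "\<lambda>x. x \<le> d" ys] by simp
    then show ?thesis unfolding eq by (intro list_emb_append_mono) auto
  qed
  ultimately have "contains_pattern (insert_entry 1 ?i \<beta>) patA"
    using iso unfolding contains_pattern_iff_subseq by metis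
  then show False using \<alpha> by (simp add: avs_def av_iff)
qed

text \<open>
  An occurrence of the pattern that uses the inserted \<open>1\<close> uses all entries before it and not the
  entry \<open>2\<close> right after it, so \<open>2\<close> can replace \<open>1\<close>.
\<close>

lemma insert_min_avoids_patA_max:
  assumes \<beta>: "\<beta> \<in> avs (k - d - 1) (d - 1) n" and n: "k - 1 \<le> n" and one: "\<beta> ! (k - d - 1) = 1"
  shows "\<not> contains_pattern (insert_entry 1 (k - d - 1) \<beta>) patA"
proof
  let ?i = "k - d - 1" and ?\<gamma> = "map (shift_from 1) \<beta>"
  have nA: "\<not> contains_pattern \<beta> patA" using \<beta> by (simp add: avs_def av_iff)
  have len: "length \<beta> = n" using \<beta> by (rule avs_length)
  have i: "?i < n" "0 < ?i" using n d_le d_ge_2 by auto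
  assume "contains_pattern (insert_entry 1 ?i \<beta>) patA"
  then obtain b1 b2 where b: "subseq b1 (take ?i ?\<gamma>)" "subseq b2 (drop ?i ?\<gamma>)"
      "order_iso (b1 @ 1 # b2) patA" "length b1 = ?i" "\<forall>x\<in>set b1 \<union> set b2. 1 < x"
    using nA avs_zero_notin[OF \<beta>]
    by (rule contains_insert_minE[of _ _ _ ?i])
      (use d_ge_2 d_le in \<open>auto simp: length_patA nth_patA_min[simplified] pat_ge_1[simplified]\<close>)
  have b1: "\<forall>x\<in>set b1. 2 < x"
  proof
    fix x assume "x \<in> set b1"
    then obtain y where "y \<in> set (take ?i \<beta>)" "x = shift_from 1 y"
      using subseq_set_subset[OF b(1)] by (auto simp: take_map)
    then show "2 < x" using \<beta> d_ge_2 by (force simp: avs_def split_at_def shift_from_def)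
  qed
  have il: "?i < length ?\<gamma>" using i len by simp
  have "?\<gamma> ! ?i = 2" using i len one by (simp add: shift_from_def)
  then have drop: "drop ?i ?\<gamma> = 2 # drop (Suc ?i) ?\<gamma>"
    using Cons_nth_drop_Suc[OF il] by metis
  obtain h b2' where h: "b2 = h # b2'" "2 < h"
  proof -
    have "Suc ?i + length b2 = k"
      using b(3,4) length_patA by (simp add: order_iso_def)
    then have "b2 \<noteq> []" using d_ge_2 d_le by auto
    then obtain h b2' where h: "b2 = h # b2'" by (cases b2) auto
    \<comment> \<open>The entry \<open>h\<close> after \<open>1\<close> plays \<open>k\<close> and
      so exceeds the first entry of the occurrence, which is already above \<open>2\<close>; hence
      \<open>h\<close> is not the entry \<open>2\<close> next to \<open>1\<close>.\<close>
    have "patA ! 0 < patA ! (Suc ?i)"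
      using nth_pat_0(1) nth_patA_max d_le by (simp add: Suc_diff_Suc)
    then have "(b1 @ 1 # b2) ! 0 < (b1 @ 1 # b2) ! (Suc ?i)"
      using order_isoD[OF b(3), of 0 "Suc ?i"] length_patA d_le d_ge_2 by simp
    then have "b1 ! 0 < h" using b(4) i h by (simp add: nth_append)
    moreover have "2 < b1 ! 0" using b1 b(4) i by simp
    ultimately show thesis using that h by simp
  qed
  then have sub: "subseq b2 (drop (Suc ?i) ?\<gamma>)"
    using b(2) unfolding drop h(1) by (simp split: if_splits)
  have "distinct (drop ?i ?\<gamma>)"
    using avs_permutation[OF \<beta>] strict_mono_shift_from strict_mono_imp_inj_on
    by (intro distinct_drop) (auto simp: distinct_map permutations_of_set_def)
  then have "2 \<notin> set b2" using subseq_set_subset[OF sub] unfolding drop by auto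
  then have "\<forall>x\<in>set b2. 2 < x" using b(5) by (metis One_nat_def Suc_1 UnI2 Suc_leI le_neq_implies_less)
  then have "order_iso (b1 @ 2 # b2) patA"
    using b(3,5) b1 by (intro order_iso_replace_min[OF b(3)]) auto
  moreover have "subseq (b1 @ 2 # b2) (take ?i ?\<gamma> @ drop ?i ?\<gamma>)"
    using b(1) sub unfolding drop by (intro list_emb_append_mono) auto
  ultimately have "contains_pattern ?\<gamma> patA"
    unfolding append_take_drop_id contains_pattern_iff_subseq by blast
  then show False using nA strict_mono_shift_from by (simp add: contains_pattern_map)
qed

text \<open>At the corner the next entry must be \<open>1\<close> (by \<open>avs_empty\<close>), and
  after deleting it the next entry must again be \<open>1\<close> (by
  \<open>avs_max_second_low\<close>). So the first set corresponds to the members of the right-hand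
  set that continue with \<open>1\<close>; the second summand counts those that do not.\<close>

lemma card_avs_max:
  assumes "k \<le> Suc (Suc m)"
  shows "card (avs (k - d - 1) d (Suc (Suc m))) + card (avs (k - d - 1) (d - 1) m) =
         card (avs (k - d - 1) (d - 1) (Suc m))"
proof -
  let ?i = "k - d - 1" and ?n = "Suc m"
  let ?M = "{\<beta> \<in> avs ?i (d - 1) ?n. \<beta> ! ?i = 1}"
  have i: "Suc ?i = k - d" "?i \<le> ?n" "?i \<le> m" "d - 1 \<le> ?n" "Suc (d - 1) = d"
    using assms d_le d_ge_2 by auto
  have n: "k - 1 \<le> ?n" using assms by simp
  \<comment> \<open>Since \<open>2 \<le> d\<close>, the bound \<open>d - 1\<close> is still
    positive, so \<open>avs_next_entry\<close> applies a second time, to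
    \<open>\<beta>\<close>.\<close>
  obtain d' where d': "d - 1 = Suc d'" "d' \<le> m" using d_ge_2 d_le assms
    by (metis Suc_le_D Suc_le_mono add_leD1 add_2_eq_Suc' diff_Suc_1 le_trans numeral_2_eq_2)
  have cases: "\<beta> \<in> avs (k - d) (d - 1) ?n \<or> \<beta> ! ?i = 1" if "\<beta> \<in> avs ?i (d - 1) ?n" for \<beta>
    using avs_next_entry[of \<beta> ?i d' m] that i d' avs_length nth_insert_entry[of ?i _ 1]
    unfolding d' by auto
  have "avs ?i d (Suc ?n) = insert_entry 1 ?i ` ?M"
  proof
    show "insert_entry 1 ?i ` ?M \<subseteq> avs ?i d (Suc ?n)"
    proof (intro image_subsetI, elim CollectE conjE)
      fix \<beta> assume \<beta>: "\<beta> \<in> avs ?i (d - 1) ?n" "\<beta> ! ?i = 1"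
      have "\<beta> \<in> av ?n" "sorted (take ?i \<beta>)" "0 \<notin> set \<beta>" "\<beta> \<in> permutations_of_set {1..?n}"
        using \<beta> avs_zero_notin avs_permutation by (auto simp: avs_def split_at_def)
      then have "insert_entry 1 ?i \<beta> \<in> av (Suc ?n)"
        using insert_entry_permutation[of \<beta> ?n 1 ?i] insert_min_avoids_321[of \<beta> ?i]
          insert_min_avoids_patA_max[OF \<beta>(1) n \<beta>(2)] insert_min_avoids_patB[of \<beta> ?i] i(1)
        unfolding av_iff by simp
      from insert_min_avs[OF \<beta>(1) i(2) this] show "insert_entry 1 ?i \<beta> \<in> avs ?i d (Suc ?n)"
        using i(5) by simp
    qed
    show "avs ?i d (Suc ?n) \<subseteq> insert_entry 1 ?i ` ?M"
    proof
      fix \<alpha> assume \<alpha>: "\<alpha> \<in> avs ?i d (Suc ?n)"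
      have "avs (k - d) d (Suc ?n) = {}" using assms d_le by (intro avs_empty) auto
      then obtain \<beta> where \<beta>: "\<beta> \<in> avs ?i (d - 1) ?n" "\<alpha> = insert_entry 1 ?i \<beta>"
        using avs_next_entry[of \<alpha> ?i "d - 1" ?n] \<alpha> i by auto
      moreover have "\<beta> ! ?i = 1"
        using cases[OF \<beta>(1)] avs_max_second_low[OF _ _ n, of \<beta>] \<alpha> \<beta>(2) by blast
      ultimately show "\<alpha> \<in> insert_entry 1 ?i ` ?M" by blast
    qed
  qed
  then have 1: "card (avs ?i d (Suc ?n)) = card ?M"
    using card_insert_entry_image[of ?M ?i "d - 1" ?n 1 ?i] by simp
  have "avs ?i (d - 1) ?n = ?M \<union> avs (k - d) (d - 1) ?n"
    using cases avs_Suc_subset[of ?i "d - 1" ?n] i(1) by auto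
  moreover have "?M \<inter> avs (k - d) (d - 1) ?n = {}"
    using avs_nth_gt[of _ ?i "d - 1" ?n] i d_ge_2 by fastforce
  ultimately have 2: "card (avs ?i (d - 1) ?n) = card ?M + card (avs (k - d) (d - 1) ?n)"
    by (metis (no_types, lifting) card_Un_disjoint finite_avs finite_Un)
  \<comment> \<open>With this set empty, the next-value recursion at \<open>l = d - 1\<close>
    reduces to an equality of two counts.\<close>
  have "avs (k - d) d ?n = {}" using assms d_le d_ge_2 by (intro avs_empty) auto
  then have "card (avs (k - d) (d - 1) ?n) = card (avs ?i (d - 1) m)"
    using card_avs_next_value[of "d - 1" m ?i] i d' d_ge_2 assms d_le by simp
  with 1 2 show ?thesis by simp
qed

end

section \<open>Rescaled Chebyshev polynomials and ballot numbers\<close>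

text \<open>\<open>chebyshev_fps m\<close> is \<open>x\<^bsup>m/2\<^esup> U\<^sub>m(1 / (2 \<surd>x))\<close>.\<close>

fun chebyshev_fps :: "nat \<Rightarrow> real fps" where
  "chebyshev_fps 0 = 1"
| "chebyshev_fps (Suc 0) = 1"
| "chebyshev_fps (Suc (Suc m)) = chebyshev_fps (Suc m) - fps_X * chebyshev_fps m"

text \<open>This is Pascal's rule; for \<open>j > m\<close> truncated subtraction gives
  \<open>0 choose j = 0\<close>, so no bound on \<open>j\<close> is needed.\<close>

lemma chebyshev_fps_nth: "chebyshev_fps m $ j = (-1) ^ j * real ((m - j) choose j)"
proof (induction m arbitrary: j rule: chebyshev_fps.induct)
  case (1 j)
  then show ?case by (cases j) auto
next
  case (2 j)
  then show ?case by (cases j) auto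
next
  case (3 m)
  show ?case
  proof (cases j)
    case 0
    then show ?thesis using "3.IH"(1)[of 0] by simp
  next
    case (Suc i)
    have "(Suc m - i) choose Suc i = ((m - i) choose Suc i) + ((m - i) choose i)"
      by (cases "i \<le> m") (simp_all add: Suc_diff_le)
    then show ?thesis using 3 Suc by (simp add: algebra_simps)
  qed
qed

lemma chebyshev_fps_nth_eq_0: "m \<le> j \<Longrightarrow> 0 < j \<Longrightarrow> chebyshev_fps m $ j = 0"
  by (simp add: chebyshev_fps_nth)

text \<open>The alternating sums of the theorem are coefficients of such products.\<close>

lemma chebyshev_fps_mult_nth:
  assumes "m \<le> n"
  shows "(chebyshev_fps m * F) $ n = (\<Sum>j=0..m. (-1) ^ j * real ((m - j) choose j) * F $ (n - j))"
proof -
  have "(chebyshev_fps m * F) $ n = (\<Sum>j=0..n. chebyshev_fps m $ j * F $ (n - j))" by (rule fps_mult_nth)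
  also have "\<dots> = (\<Sum>j=0..m. chebyshev_fps m $ j * F $ (n - j))"
    using assms by (intro sum.mono_neutral_right) (auto simp: chebyshev_fps_nth)
  finally show ?thesis by (simp add: chebyshev_fps_nth)
qed

lemma chebyshev_fps_mult_nth_Suc:
  "(chebyshev_fps (Suc (Suc m)) * F) $ Suc n = (chebyshev_fps (Suc m) * F) $ Suc n - (chebyshev_fps m * F) $ n"
  by (simp add: left_diff_distrib mult.assoc)

text \<open>The ballot number is written so that it is meaningful for \<open>q = 0\<close> and its recursion is Pascal's rule.\<close>

lemma ballot_numbers:
  fixes f :: "nat \<Rightarrow> nat \<Rightarrow> real"
  assumes diag: "\<And>n. n \<le> K \<Longrightarrow> f n n = 1"
    and bd: "\<And>n. f 0 n = f 1 n"
    and rec: "\<And>m n. f (Suc (Suc m)) (Suc n) = f (Suc m) (Suc n) - f m n"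
    and "n \<le> K" "q \<le> n"
  shows "f (n - q) n = real ((n + q) choose q) - real ((n + q) choose Suc n)"
  using assms(4,5)
proof (induction n arbitrary: q)
  case 0
  then show ?case using diag[of 0] by simp
next
  case (Suc n)
  note outer_IH = Suc.IH and \<open>Suc n \<le> K\<close>
  from Suc.prems(2) show ?case
  proof (induction q)
    case 0
    then show ?case using diag[of "Suc n"] Suc.prems(1) by (simp add: binomial_eq_0)
  next
    case (Suc q)
    note IH = Suc.IH
    show ?case
    proof (cases "q = n")
      case True
      \<comment> \<open>On the boundary the value is merely repeated. The Pascal expansions of both
        new binomials contain \<open>(2 * n + 1) choose (n + 1)\<close>, which cancels.\<close>
      have "f (Suc n - Suc q) (Suc n) = f (Suc n - q) (Suc n)" using bd True by simp
      then show ?thesis using IH True by simp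
    next
      case False
      then obtain m where m: "n = Suc q + m" using Suc.prems le_Suc_ex[of "Suc q" n] by auto
      have "f (Suc n - Suc q) (Suc n) = f (Suc n - q) (Suc n) + f (n - Suc q) n"
        using rec[of m n] m by simp
      moreover have "f (n - Suc q) n = real ((n + Suc q) choose Suc q) - real ((n + Suc q) choose Suc n)"
        using m \<open>Suc n \<le> K\<close> by (intro outer_IH) auto
      ultimately show ?thesis using IH m by simp
    qed
  qed
qed

text \<open>The two absorption identities give
  \<open>(n + 1) * (2n choose n + 1) = n * (2n choose n)\<close>.\<close>

lemma catalan_binomial_diff:
  "real ((2 * n) choose n) - real ((2 * n) choose Suc n) = 1 / (real n + 1) * real ((2 * n) choose n)"
proof -
  have "Suc n * ((2 * n) choose Suc n) = 2 * n * ((2 * n - 1) choose n)"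
    by (rule binomial_absorption)
  also have "\<dots> = (2 * n - n) * ((2 * n) choose n)"
    by (rule binomial_absorb_comp[symmetric])
  finally have "Suc n * ((2 * n) choose Suc n) = n * ((2 * n) choose n)" by simp
  then have "(real n + 1) * real ((2 * n) choose Suc n) = real n * real ((2 * n) choose n)"
    by (simp only: of_nat_mult[symmetric] of_nat_Suc[symmetric] add.commute[of _ 1])
  moreover have "a - b = 1 / (x + 1) * a" if "(x + 1) * b = x * a" "0 \<le> x" for a b x :: real
    using that by (simp add: field_simps)
  ultimately show ?thesis by simp
qed

section \<open>From the trigonometric definition of \<open>U\<close> to its rescaled power
  series\<close>

lemma chebyshev_U_0: "chebyshev_U 0 = 1"
  by (rule chebyshev_U_unique) (simp add: poly_chebyshev_U_cos)

lemma chebyshev_U_1: "chebyshev_U (Suc 0) = [:0, 2:]"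
  by (rule chebyshev_U_unique) (simp add: poly_chebyshev_U_cos sin_double)

text \<open>The addition formulas for sine give the recurrence at every \<open>cos \<theta>\<close>
  with \<open>sin \<theta> \<noteq> 0\<close>, which determines the polynomial.\<close>

lemma chebyshev_U_Suc_Suc:
  "chebyshev_U (Suc (Suc m)) = pCons 0 (smult 2 (chebyshev_U (Suc m))) - chebyshev_U m"
proof (rule chebyshev_U_unique)
  fix \<theta> :: real assume s: "sin \<theta> \<noteq> 0"
  let ?a = "real (m + 2) * \<theta>"
  have "sin (?a + \<theta>) = 2 * cos \<theta> * sin ?a - sin (?a - \<theta>)"
    by (simp add: sin_add sin_diff)
  moreover have "?a + \<theta> = real (Suc (Suc m) + 1) * \<theta>" "?a - \<theta> = real (m + 1) * \<theta>"
    "?a = real (Suc m + 1) * \<theta>"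
    by (simp_all add: algebra_simps)
  ultimately show "poly (chebyshev_U (Suc (Suc m))) (cos \<theta>) =
      poly (pCons 0 (smult 2 (chebyshev_U (Suc m))) - chebyshev_U m) (cos \<theta>)"
    using s by (simp add: poly_chebyshev_U_cos diff_divide_distrib del: of_nat_Suc of_nat_add)
qed

lemma map_poly_fls_const_diff:
  "map_poly fls_const (p - q) = map_poly fls_const p - map_poly fls_const (q :: real poly)"
  by (intro poly_eqI) (simp add: coeff_map_poly fls_minus_const)

lemma U_at_0: "U_at 0 = 1"
  by (simp add: U_at_def chebyshev_U_0)

lemma fls_X_times_half_inverse: "fls_X * (1 / (2 * fls_X) * 2) = (1 :: real fls)"
proof -
  have "x * (1 / (2 * x) * 2) = 1" if "x \<noteq> 0" "(2 :: 'a) \<noteq> 0" for x :: "'a :: field"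
    using that by simp
  moreover have "(2 :: real fls) \<noteq> 0" by simp
  ultimately show ?thesis using fls_X_nonzero by blast
qed

lemma U_at_1: "fls_X * U_at (Suc 0) = 1"
proof -
  define y :: "real fls" where "y = 1 / (2 * fls_X)"
  have "U_at (Suc 0) = y * 2"
    unfolding U_at_def chebyshev_U_1 y_def[symmetric] by (simp add: map_poly_pCons)
  then have "U_at (Suc 0) = 1 / (2 * fls_X) * 2" unfolding y_def .
  then show ?thesis using fls_X_times_half_inverse by (simp only:)
qed

lemma U_at_Suc_Suc: "fls_X * U_at (Suc (Suc m)) = U_at (Suc m) - fls_X * U_at m"
proof -
  define y :: "real fls" where "y = 1 / (2 * fls_X)"
  have y: "fls_X * (y * 2) = 1" unfolding y_def by (rule fls_X_times_half_inverse)
  have "U_at (Suc (Suc m)) = (y * 2) * U_at (Suc m) - U_at m"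
    unfolding U_at_def y_def[symmetric] chebyshev_U_Suc_Suc map_poly_fls_const_diff
    by (simp add: map_poly_pCons map_poly_smult)
  then have "fls_X * U_at (Suc (Suc m)) = (fls_X * (y * 2)) * U_at (Suc m) - fls_X * U_at m"
    by (simp only: right_diff_distrib mult.assoc)
  then show ?thesis unfolding y by simp
qed

text \<open>Here \<open>fls_X\<close> is the square root of x, so composing with
  \<open>fps_X ^ 2\<close> substitutes x. The power of \<open>fls_X\<close> clears the denominators
  and turns the recurrence of \<open>U_at\<close> into that of \<open>chebyshev_fps\<close>.\<close>

lemma fls_X_power_U_at: "fls_X ^ m * U_at m = fps_to_fls (chebyshev_fps m oo fps_X ^ 2)"
proof (induction m rule: chebyshev_fps.induct)
  case 1
  then show ?case by (simp add: U_at_0)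
next
  case 2
  then show ?case by (simp add: U_at_1)
next
  case (3 m)
  have "fls_X ^ Suc (Suc m) * U_at (Suc (Suc m)) = fls_X ^ Suc m * (fls_X * U_at (Suc (Suc m)))"
    by (simp only: power_Suc mult_ac)
  also have "\<dots> = fls_X ^ Suc m * U_at (Suc m) - fls_X ^ 2 * (fls_X ^ m * U_at m)"
    unfolding U_at_Suc_Suc by (simp only: power_Suc power2_eq_square right_diff_distrib mult_ac)
  also have "\<dots> = fps_to_fls ((chebyshev_fps (Suc m) oo fps_X ^ 2) - fps_X ^ 2 * (chebyshev_fps m oo fps_X ^ 2))"
    using 3 by (simp add: fps_to_fls_minus fls_times_fps_to_fls fps_to_fls_power)
  also have "(chebyshev_fps (Suc m) oo fps_X ^ 2) - fps_X ^ 2 * (chebyshev_fps m oo fps_X ^ 2) = chebyshev_fps (Suc (Suc m)) oo fps_X ^ 2"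
    by (simp add: fps_compose_sub_distrib fps_compose_mult_distrib)
  finally show ?case .
qed

lemma chebyshev_quotient:
  assumes "k \<ge> 3" and eq: "(chebyshev_fps k + fps_X ^ 2 * chebyshev_fps (k - 2)) * F = chebyshev_fps (k - 1) + fps_X ^ 2 * chebyshev_fps (k - 3)"
  shows "fps_to_fls (F oo fps_X ^ 2) =
     (U_at (k - 1) + fls_X ^ 2 * U_at (k - 3)) / (fls_X * (U_at k + fls_X ^ 2 * U_at (k - 2)))"
proof -
  obtain m where m: "k = Suc (Suc (Suc m))" using assms(1) by (metis Suc_le_D numeral_3_eq_3 Suc_le_mono)
  define c where "c = (\<lambda>m. fps_to_fls (chebyshev_fps m oo fps_X ^ 2))"
  let ?G = "fps_to_fls (F oo fps_X ^ 2)"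
  let ?N = "U_at (k - 1) + fls_X ^ 2 * U_at (k - 3)"
  let ?D = "fls_X * (U_at k + fls_X ^ 2 * U_at (k - 2))"
  have xu: "fls_X ^ m * U_at m = c m" for m by (simp add: c_def fls_X_power_U_at)
  \<comment> \<open>Numerator and denominator are both scaled by \<open>fls_X ^ (k - 1)\<close>,
    which makes them power series in x.\<close>
  have N: "fls_X ^ Suc (Suc m) * ?N = c (k - 1) + fls_X ^ 4 * c (k - 3)"
    unfolding xu[symmetric] m by (simp add: algebra_simps power_Suc eval_nat_numeral)
  have D: "fls_X ^ Suc (Suc m) * ?D = c k + fls_X ^ 4 * c (k - 2)"
    unfolding xu[symmetric] m by (simp add: algebra_simps power_Suc eval_nat_numeral)
  have "((chebyshev_fps k + fps_X ^ 2 * chebyshev_fps (k - 2)) oo fps_X ^ 2) * (F oo fps_X ^ 2) =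
      (chebyshev_fps (k - 1) + fps_X ^ 2 * chebyshev_fps (k - 3)) oo fps_X ^ 2"
    unfolding eq[symmetric] by (simp add: fps_compose_mult_distrib)
  moreover have "(fps_X ^ 2 :: real fps) oo fps_X ^ 2 = fps_X ^ 4"
    by (simp add: fps_compose_power[symmetric] power_mult[symmetric])
  ultimately have "((chebyshev_fps k oo fps_X ^ 2) + fps_X ^ 4 * (chebyshev_fps (k - 2) oo fps_X ^ 2)) * (F oo fps_X ^ 2) =
      (chebyshev_fps (k - 1) oo fps_X ^ 2) + fps_X ^ 4 * (chebyshev_fps (k - 3) oo fps_X ^ 2)"
    by (simp add: fps_compose_add_distrib fps_compose_mult_distrib)
  then have "fps_to_fls (((chebyshev_fps k oo fps_X ^ 2) + fps_X ^ 4 * (chebyshev_fps (k - 2) oo fps_X ^ 2)) * (F oo fps_X ^ 2)) =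
      fps_to_fls ((chebyshev_fps (k - 1) oo fps_X ^ 2) + fps_X ^ 4 * (chebyshev_fps (k - 3) oo fps_X ^ 2))"
    by (rule arg_cong)
  then have G: "(c k + fls_X ^ 4 * c (k - 2)) * ?G = c (k - 1) + fls_X ^ 4 * c (k - 3)"
    by (simp add: c_def fps_to_fls_plus fls_times_fps_to_fls fps_to_fls_power)
  \<comment> \<open>The constant term 1 shows that the scaled denominator is nonzero, which permits
    the division.\<close>
  have "((chebyshev_fps k oo fps_X ^ 2) + fps_X ^ 4 * (chebyshev_fps (k - 2) oo fps_X ^ 2)) $ 0 = 1"
    by (simp add: chebyshev_fps_nth)
  then have "fps_to_fls ((chebyshev_fps k oo fps_X ^ 2) + fps_X ^ 4 * (chebyshev_fps (k - 2) oo fps_X ^ 2)) \<noteq> 0"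
    by (metis fps_to_fls_eq_0_iff fps_zero_nth zero_neq_one)
  then have nz: "c k + fls_X ^ 4 * c (k - 2) \<noteq> 0"
    by (simp add: c_def fps_to_fls_plus fls_times_fps_to_fls fps_to_fls_power)
  have "fls_X ^ Suc (Suc m) * (?D * ?G) = fls_X ^ Suc (Suc m) * ?N"
    using G unfolding N D[symmetric] by (simp add: mult.assoc)
  then have "?D * ?G = ?N" by simp
  moreover have "?D \<noteq> 0" using nz unfolding D[symmetric] by simp
  ultimately show ?thesis by (simp add: field_simps)
qed

section \<open>The generating function\<close>

context pattern_X2
begin

definition gf :: "real fps" where "gf = Abs_fps (\<lambda>n. real (x2 k d n))"

lemma gf_nth: "gf $ n = real (x2 k d n)"
  by (simp add: gf_def)

text \<open>Both sides equal f(i + 1, l + 1; n + 1) + f(i, l; n) by the two recursions, so the count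
  depends only on the sum of the two parameters.\<close>

lemma card_avs_diagonal:
  assumes "i < k - d - 1" "l < d" "i \<le> n" "l \<le> n"
  shows "card (avs i (Suc l) (Suc n)) = card (avs (Suc i) l (Suc n))"
  using card_avs_next_entry[of i n l] card_avs_next_value[of l n i] assms by simp

lemma avs_trivial:
  assumes "i \<le> 1"
  shows "avs i 0 n = av n"
proof -
  have "split_at i 0 \<alpha>" if "\<alpha> \<in> av n" for \<alpha>
  proof -
    have "0 \<notin> set \<alpha>" using that by (auto simp: av_iff permutations_of_set_def)
    then have "filter (\<lambda>x. x \<le> 0) \<alpha> = []" by (auto simp: filter_empty_conv intro: gr0I)
    moreover have "sorted (take i \<alpha>)" using assms by (cases \<alpha>; cases i) auto
    moreover have "\<forall>x\<in>set (take i \<alpha>). 0 < x" using \<open>0 \<notin> set \<alpha>\<close> by (metis gr0I in_set_takeD)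
    ultimately show ?thesis by (simp add: split_at_def)
  qed
  then show ?thesis by (auto simp: avs_def)
qed

lemma card_av: "card (av n) = x2 k d n"
  by (simp add: av_def x2_def)

lemma card_avs_positive:
  assumes IH: "\<And>i l n. \<lbrakk>i + l \<le> Suc m; i \<le> k - d - 1; l \<le> d; i + l \<le> n\<rbrakk> \<Longrightarrow>
      real (card (avs i l n)) = (chebyshev_fps (i + l) * gf) $ n"
    and "i + l = m" "Suc i \<le> k - d - 1" "Suc l \<le> d" "i + l \<le> n"
  shows "real (card (avs (Suc i) (Suc l) (Suc n))) = (chebyshev_fps (Suc i + Suc l) * gf) $ Suc n"
proof -
  have "card (avs i (Suc l) (Suc n)) = card (avs (Suc i) (Suc l) (Suc n)) + card (avs i l n)"
    using assms by (intro card_avs_next_entry) auto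
  then have "real (card (avs (Suc i) (Suc l) (Suc n))) =
      real (card (avs i (Suc l) (Suc n))) - real (card (avs i l n))" by simp
  also have "\<dots> = (chebyshev_fps (Suc m) * gf) $ Suc n - (chebyshev_fps m * gf) $ n"
    using IH[of i "Suc l" "Suc n"] IH[of i l n] assms(2-5) by simp
  also have "\<dots> = (chebyshev_fps (Suc (Suc m)) * gf) $ Suc n" by (rule chebyshev_fps_mult_nth_Suc[symmetric])
  finally show ?thesis using assms(2) by simp
qed

text \<open>Induction on \<open>i + l\<close>. With both parameters positive, the next-entry
  recursion matches the recurrence of \<open>chebyshev_fps\<close>; if one of them is 0,
  \<open>card_avs_diagonal\<close> first moves one unit over to it.\<close>

lemma card_avs:
  assumes "i \<le> k - d - 1" "l \<le> d" "i + l \<le> n"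
  shows "real (card (avs i l n)) = (chebyshev_fps (i + l) * gf) $ n"
  using assms
proof (induction "i + l" arbitrary: i l n rule: less_induct)
  case less
  have pos: "1 \<le> k - d - 1" "1 \<le> d" using d_le d_ge_2 by auto
  show ?case
  proof (cases "i + l \<le> 1")
    case True
    then consider "l = 0" "i \<le> 1" | "i = 0" "l = Suc 0" by linarith
    then show ?thesis
    proof cases
      case 1
      then have "chebyshev_fps (i + l) = 1" by (cases i) auto
      then show ?thesis using 1 by (simp add: avs_trivial card_av gf_nth)
    next
      case 2
      then obtain n' where "n = Suc n'" using less.prems(3) by (cases n) auto
      then have "card (avs i l n) = card (avs 1 0 n)"
        using card_avs_diagonal[of 0 0 n'] pos 2 by simp
      then show ?thesis using 2 by (simp add: avs_trivial card_av gf_nth)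
    qed
  next
    case False
    then obtain m where m: "i + l = Suc (Suc m)" by (metis One_nat_def Suc_le_mono le0 not0_implies_Suc)
    then obtain n' where n': "n = Suc n'" using less.prems(3) by (cases n) auto
    have pp: "real (card (avs (Suc i') (Suc l') (Suc n'))) = (chebyshev_fps (Suc i' + Suc l') * gf) $ Suc n'"
      if "i' + l' = m" "Suc i' \<le> k - d - 1" "Suc l' \<le> d" for i' l'
    proof (rule card_avs_positive[OF _ that])
      show "i' + l' \<le> n'" using that(1) m n' less.prems(3) by simp
    next
      fix i l n assume "i + l \<le> Suc m" "i \<le> k - d - 1" "l \<le> d" "i + l \<le> n"
      then show "real (card (avs i l n)) = (chebyshev_fps (i + l) * gf) $ n"
        using less.hyps[of i l n] m by simp
    qed
    consider i' l' where "i = Suc i'" "l = Suc l'" | "i = 0" | "l = 0"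
      by (cases i; cases l) auto
    then show ?thesis
    proof cases
      case 1
      then show ?thesis using pp[of i' l'] m n' less.prems by simp
    next
      case 2
      then have "card (avs i l n) = card (avs (Suc 0) (Suc m) n)"
        using card_avs_diagonal[of 0 "Suc m" n'] pos less.prems m n' by simp
      then show ?thesis using pp[of 0 m] 2 pos less.prems m n' by simp
    next
      case 3
      then have "card (avs i l n) = card (avs (Suc m) (Suc 0) n)"
        using card_avs_diagonal[of "Suc m" 0 n'] pos less.prems m n' by simp
      then show ?thesis using pp[of m 0] 3 pos less.prems m n' by simp
    qed
  qed
qed

lemma gf_linear_relation:
  assumes "k \<le> Suc (Suc m)"
  shows "(chebyshev_fps (k - 1) * gf) $ Suc (Suc m) + (chebyshev_fps (k - 2) * gf) $ m = (chebyshev_fps (k - 2) * gf) $ Suc m"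
proof -
  have eq: "k - d - 1 + d = k - 1" "k - d - 1 + (d - 1) = k - 2" using d_le d_ge_2 by auto
  have "real (card (avs (k - d - 1) d (Suc (Suc m)))) = (chebyshev_fps (k - 1) * gf) $ Suc (Suc m)"
    using card_avs[of "k - d - 1" d "Suc (Suc m)"] assms unfolding eq by simp
  moreover have "real (card (avs (k - d - 1) (d - 1) n)) = (chebyshev_fps (k - 2) * gf) $ n" if "m \<le> n" for n
    using card_avs[of "k - d - 1" "d - 1" n] assms that unfolding eq by simp
  ultimately show ?thesis using card_avs_max[OF assms] by (metis le_refl le_SucI of_nat_add)
qed

section \<open>Lengths below \<open>k\<close>: ballot and Catalan numbers\<close>

lemma avs_tight_singleton:
  assumes n: "i + l = n" "n < k"
  shows "avs i l n = {[Suc l..<Suc n] @ [1..<Suc l]}"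
proof (intro equalityI subsetI)
  fix \<alpha> assume \<alpha>: "\<alpha> \<in> avs i l n"
  have perm: "set \<alpha> = {1..n}" "distinct \<alpha>" and len: "length \<alpha> = n"
    using avs_permutation[OF \<alpha>] avs_length[OF \<alpha>] by (auto simp: permutations_of_set_def)
  have t: "sorted (take i \<alpha>)" "\<forall>x\<in>set (take i \<alpha>). l < x" using \<alpha> by (auto simp: avs_def split_at_def)
  \<comment> \<open>The \<open>i\<close> distinct entries exceed \<open>l\<close>, and only
    \<open>i = n - l\<close> values do; so the beginning is forced, and then the rest.\<close>
  have "set (take i \<alpha>) = {Suc l..n}"
  proof (rule card_subset_eq)
    show "set (take i \<alpha>) \<subseteq> {Suc l..n}"
    proof
      fix x assume x: "x \<in> set (take i \<alpha>)"
      then have "x \<in> {1..n}" using in_set_takeD[OF x] perm(1) by simp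
      with x t(2) show "x \<in> {Suc l..n}" by (simp add: Suc_le_eq)
    qed
    have "card (set (take i \<alpha>)) = length (take i \<alpha>)"
      using perm(2) by (intro distinct_card distinct_take)
    then show "card (set (take i \<alpha>)) = card {Suc l..n}" using len n(1) by simp
  qed simp
  then have take: "take i \<alpha> = [Suc l..<Suc n]"
    using t(1) distinct_take[OF perm(2)]
    by (intro sorted_distinct_set_unique) (simp_all add: atLeastLessThanSuc_atLeastAtMost del: upt_Suc)
  have "set (drop i \<alpha>) \<subseteq> {1..n}" using set_drop_subset[of i \<alpha>] perm(1) by simp
  have disj: "set (take i \<alpha>) \<inter> set (drop i \<alpha>) = {}"
    using perm(2) by (rule set_take_disj_set_drop_if_distinct) simp
  then have "\<forall>x\<in>set (drop i \<alpha>). x \<le> l"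
  proof (intro ballI)
    fix x assume x: "x \<in> set (drop i \<alpha>)"
    with disj have "x \<notin> {Suc l..n}"
      unfolding \<open>set (take i \<alpha>) = {Suc l..n}\<close> by blast
    moreover have "x \<le> n" using x \<open>set (drop i \<alpha>) \<subseteq> {1..n}\<close> by auto
    ultimately show "x \<le> l" by simp
  qed
  then have "filter (\<lambda>x. x \<le> l) (drop i \<alpha>) = drop i \<alpha>" by (simp add: filter_id_conv)
  moreover have "filter (\<lambda>x. x \<le> l) (take i \<alpha>) = []" using t(2) by (force simp: filter_empty_conv)
  moreover have "filter (\<lambda>x. x \<le> l) (take i \<alpha> @ drop i \<alpha>) = [1..<Suc l]"
    using avs_low_entries[OF \<alpha>] n(1) by simp
  ultimately have "drop i \<alpha> = [1..<Suc l]" by (simp only: filter_append append_Nil)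
  with take show "\<alpha> \<in> {[Suc l..<Suc n] @ [1..<Suc l]}"
    using append_take_drop_id[of i \<alpha>] by (simp only: singleton_iff)
next
  fix \<alpha> assume "\<alpha> \<in> {[Suc l..<Suc n] @ [1..<Suc l]}"
  then have \<alpha>: "\<alpha> = [Suc l..<Suc n] @ [1..<Suc l]" by simp
  have perm: "\<alpha> \<in> permutations_of_set {1..n}"
    using n(1) unfolding \<alpha> permutations_of_set_def by (auto simp del: upt_Suc)
  then have "length \<alpha> < k" using n(2) length_finite_permutations_of_set[of \<alpha> "{1..n}"] by simp
  then have "\<not> contains_pattern \<alpha> patA" "\<not> contains_pattern \<alpha> patB"
    using contains_pattern_length[of \<alpha>] length_patA length_patB by (metis not_le)+
  moreover have "\<not> contains_pattern \<alpha> [3, 2, 1]"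
  proof
    assume "contains_pattern \<alpha> [3, 2, 1]"
    then obtain x y z where xyz: "subseq [x, y, z] \<alpha>" "z < y" "y < x"
      unfolding contains_321_iff by blast
    then obtain b c where bc: "[x, y, z] = b @ c" "subseq b [Suc l..<Suc n]" "subseq c [1..<Suc l]"
      unfolding \<alpha> by (auto simp: subseq_append_iff)
    \<comment> \<open>Of three entries shared between two increasing runs, two consecutive ones fall
      into the same run, so they cannot descend.\<close>
    have "sorted b" "sorted c" using bc(2,3) sorted_subseq sorted_upt by blast+
    with bc(1) xyz(2,3) show False by (auto simp: Cons_eq_append_conv)
  qed
  moreover have "split_at i l \<alpha>"
    unfolding \<alpha> using n(1) by (subst split_at_append) (auto simp del: upt_Suc simp: sorted_wrt_filter)
  ultimately show "\<alpha> \<in> avs i l n" using perm by (simp add: avs_def av_iff)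
qed

lemma gf_diagonal:
  assumes "n \<le> k - 1"
  shows "(chebyshev_fps n * gf) $ n = 1"
proof -
  \<comment> \<open>This splits \<open>n \<le> k - 1 = (k - d - 1) + d\<close> into two parts that
    respect the bounds of \<open>card_avs\<close>.\<close>
  define i where "i = min n (k - d - 1)"
  have il: "i \<le> k - d - 1" "n - i \<le> d" "i + (n - i) = n" "n < k"
    using assms d_le d_ge_2 by (auto simp: i_def)
  have "(chebyshev_fps (i + (n - i)) * gf) $ n = real (card (avs i (n - i) n))"
    using il by (intro card_avs[symmetric]) auto
  also have "\<dots> = 1" unfolding avs_tight_singleton[OF il(3,4)] by simp
  finally show ?thesis using il(3) by simp
qed

lemma gf_catalan:
  assumes "n \<le> k - 1"
  shows "real (x2 k d n) = 1 / (real n + 1) * real ((2 * n) choose n)"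
proof -
  \<comment> \<open>The left side is \<open>gf $ n\<close>; the form \<open>n - n\<close> matches
    \<open>ballot_numbers\<close> at \<open>q = n\<close>.\<close>
  have "(chebyshev_fps (n - n) * gf) $ n = real ((n + n) choose n) - real ((n + n) choose Suc n)"
    by (rule ballot_numbers[where K = "k - 1" and f = "\<lambda>m n. (chebyshev_fps m * gf) $ n"])
      (use assms in \<open>auto simp: gf_diagonal chebyshev_fps_mult_nth_Suc simp del: chebyshev_fps.simps(3)\<close>)
  then show ?thesis using catalan_binomial_diff[of n] by (simp add: gf_nth mult_2)
qed

text \<open>Below degree \<open>m\<close> both sides satisfy the same recurrence. In degree
  \<open>m \<ge> 2\<close> two diagonal coefficients, both equal to 1, cancel, in agreement with the
  vanishing coefficient of \<open>chebyshev_fps m\<close>.\<close>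

lemma gf_truncated:
  assumes "Suc m \<le> k" "n \<le> m"
  shows "(chebyshev_fps (Suc m) * gf) $ n = chebyshev_fps m $ n"
  using assms
proof (induction m arbitrary: n rule: less_induct)
  case (less m)
  have diag: "(chebyshev_fps m * gf) $ m = 1" using less.prems(1) by (intro gf_diagonal) simp
  have zero: "gf $ 0 = 1" using gf_diagonal[of 0] by simp
  consider "m = 0" | "m = Suc 0" | j where "m = Suc (Suc j)" by (metis not0_implies_Suc)
  then show ?case
  proof cases
    case 1
    then show ?thesis using less.prems zero by simp
  next
    case 2
    then consider "n = 0" | "n = Suc 0" using less.prems by linarith
    then show ?thesis using 2 diag zero by cases (auto simp: left_diff_distrib)
  next
    case 3
    show ?thesis
    proof (cases n)
      case 0
      then show ?thesis using zero by (simp add: chebyshev_fps_nth fps_mult_nth)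
    next
      case (Suc n')
      have step: "(chebyshev_fps (Suc m) * gf) $ n = (chebyshev_fps m * gf) $ n - (chebyshev_fps (Suc j) * gf) $ n'"
        unfolding 3 Suc by (rule chebyshev_fps_mult_nth_Suc)
      show ?thesis
      proof (cases "n = m")
        case True
        have "(chebyshev_fps (Suc j) * gf) $ n' = 1" using True 3 Suc less.prems by (auto intro: gf_diagonal)
        then show ?thesis using step diag True 3 chebyshev_fps_nth_eq_0[of m m] by simp
      next
        case False
        then have "(chebyshev_fps m * gf) $ n = chebyshev_fps (Suc j) $ n" "(chebyshev_fps (Suc j) * gf) $ n' = chebyshev_fps j $ n'"
          using less.IH[of "Suc j" n] less.IH[of j n'] less.prems 3 Suc by auto
        then show ?thesis using step 3 Suc by simp
      qed
    qed
  qed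
qed

text \<open>Coefficients are compared: below degree \<open>k\<close> by truncating both products,
  and from \<open>k\<close> on the left side vanishes by the corner relation while the polynomials
  on the right have smaller degree.\<close>

lemma gf_quotient:
  "(chebyshev_fps k + fps_X ^ 2 * chebyshev_fps (k - 2)) * gf = chebyshev_fps (k - 1) + fps_X ^ 2 * chebyshev_fps (k - 3)"
proof (rule fps_ext)
  fix n
  obtain j where k: "k - 1 = Suc (Suc j)" "k - 2 = Suc j" "k - 3 = j" "Suc (Suc (Suc j)) \<le> k"
    and ck: "chebyshev_fps k = chebyshev_fps (Suc (Suc (Suc j)))"
  proof -
    have "k = Suc (Suc (Suc (k - 3)))" using d_le d_ge_2 by simp
    then show thesis using that[of "k - 3"] by (metis diff_Suc_1 diff_Suc_Suc le_refl numeral_2_eq_2 numeral_3_eq_3 diff_zero)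
  qed
  have lhs: "((chebyshev_fps k + fps_X ^ 2 * chebyshev_fps (k - 2)) * gf) $ n =
      (chebyshev_fps k * gf) $ n + (if n < 2 then 0 else (chebyshev_fps (k - 2) * gf) $ (n - 2))"
    by (simp add: distrib_right mult.assoc fps_X_power_mult_nth)
  have rhs: "(chebyshev_fps (k - 1) + fps_X ^ 2 * chebyshev_fps (k - 3)) $ n =
      chebyshev_fps (k - 1) $ n + (if n < 2 then 0 else chebyshev_fps (k - 3) $ (n - 2))"
    by (simp add: fps_X_power_mult_nth)
  show "((chebyshev_fps k + fps_X ^ 2 * chebyshev_fps (k - 2)) * gf) $ n = (chebyshev_fps (k - 1) + fps_X ^ 2 * chebyshev_fps (k - 3)) $ n"
  proof (cases "n < k")
    case True
    have "(chebyshev_fps k * gf) $ n = chebyshev_fps (k - 1) $ n"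
      unfolding ck k(1) using True k(1,4) by (intro gf_truncated) auto
    moreover have "(chebyshev_fps (k - 2) * gf) $ (n - 2) = chebyshev_fps (k - 3) $ (n - 2)" if "2 \<le> n"
      unfolding k(2,3) using True k(1,4) that by (intro gf_truncated) auto
    ultimately show ?thesis unfolding lhs rhs by simp
  next
    case False
    define m where "m = n - 2"
    have m: "n = Suc (Suc m)" "k \<le> Suc (Suc m)" using False k(4) by (simp_all add: m_def)
    have "(chebyshev_fps k * gf) $ n = (chebyshev_fps (k - 1) * gf) $ n - (chebyshev_fps (k - 2) * gf) $ Suc m"
      unfolding ck k(1,2) m(1) by (rule chebyshev_fps_mult_nth_Suc)
    then have "(chebyshev_fps k * gf) $ n + (chebyshev_fps (k - 2) * gf) $ m = 0"
      using gf_linear_relation[OF m(2)] unfolding m(1) by simp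
    moreover have "chebyshev_fps (k - 1) $ n = 0" using m by (intro chebyshev_fps_nth_eq_0) auto
    moreover have "chebyshev_fps (k - 3) $ m = 0" using m k(4) by (intro chebyshev_fps_nth_eq_0) auto
    ultimately show ?thesis unfolding lhs rhs using m(1) by simp
  qed
qed

text \<open>In the corner relation, the terms with \<open>chebyshev_fps (k - 2)\<close> at
  \<open>n - 1\<close> and \<open>n - 2\<close> are rewritten by the three-term recurrence; the two
  terms with \<open>chebyshev_fps (k - 3)\<close> cancel.\<close>

lemma gf_recurrence:
  assumes "k \<le> n"
  shows "(chebyshev_fps (k - 1) * gf) $ n = (chebyshev_fps (k - 1) * gf) $ (n - 1) + (chebyshev_fps (k - 4) * gf) $ (n - 3)"
proof -
  obtain m j where m: "n = Suc (Suc (Suc m))" and j: "k = Suc (Suc (Suc (Suc j)))"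
  proof -
    have "4 \<le> k" "4 \<le> n" using assms d_le d_ge_2 by auto
    then show thesis using that[of "n - 3" "k - 4"] by (simp add: numeral_eq_Suc)
  qed
  have "(chebyshev_fps (k - 1) * gf) $ n + (chebyshev_fps (k - 2) * gf) $ Suc m = (chebyshev_fps (k - 2) * gf) $ Suc (Suc m)"
    using gf_linear_relation[of "Suc m"] assms m by simp
  moreover have "(chebyshev_fps (k - 1) * gf) $ (n - 1) = (chebyshev_fps (k - 2) * gf) $ Suc (Suc m) - (chebyshev_fps (k - 3) * gf) $ Suc m"
    using chebyshev_fps_mult_nth_Suc[of "Suc j" gf "Suc m"] unfolding j m by (simp del: chebyshev_fps.simps add: numeral_eq_Suc)
  moreover have "(chebyshev_fps (k - 2) * gf) $ Suc m = (chebyshev_fps (k - 3) * gf) $ Suc m - (chebyshev_fps (k - 4) * gf) $ (n - 3)"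
    using chebyshev_fps_mult_nth_Suc[of j gf m] unfolding j m by (simp del: chebyshev_fps.simps add: numeral_eq_Suc)
  ultimately show ?thesis by simp
qed

end

theorem theorem3p2:
  fixes k d :: nat
  assumes "k \<ge> 4" and "2 \<le> d" and "d \<le> k - 2"
  shows "(\<forall>n\<ge>k.
            (\<Sum>j=0..k-1. (-1) ^ j * int ((k - 1 - j) choose j) * int (x2 k d (n - j))) =
            (\<Sum>j=0..k-1. (-1) ^ j * int ((k - 1 - j) choose j) * int (x2 k d (n - 1 - j))) +
            (\<Sum>j=0..k-4. (-1) ^ j * int ((k - 4 - j) choose j) * int (x2 k d (n - 3 - j)))) \<and>
         (\<forall>n\<le>k-1. real (x2 k d n) = 1 / (real n + 1) * real ((2 * n) choose n)) \<and>
         fps_to_fls (fps_compose (Abs_fps (\<lambda>n. real (x2 k d n))) (fps_X ^ 2)) =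
           (U_at (k - 1) + fls_X ^ 2 * U_at (k - 3)) /
           (fls_X * (U_at k + fls_X ^ 2 * U_at (k - 2)))"
proof (intro conjI allI impI)
  interpret pattern_X2 k d using assms by unfold_locales auto
  \<comment> \<open>The integer sums are compared inside the reals, where they are coefficients of
    power series.\<close>
  have sums: "real_of_int (\<Sum>j=0..m. (-1) ^ j * int ((m - j) choose j) * int (x2 k d (n - j))) =
      (chebyshev_fps m * gf) $ n" if "m \<le> n" for m n
    using that by (simp add: chebyshev_fps_mult_nth gf_nth)
  fix n
  {
    assume n: "k \<le> n"
    have "real_of_int (\<Sum>j=0..k-1. (-1) ^ j * int ((k - 1 - j) choose j) * int (x2 k d (n - j))) =
      real_of_int ((\<Sum>j=0..k-1. (-1) ^ j * int ((k - 1 - j) choose j) * int (x2 k d (n - 1 - j))) +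
        (\<Sum>j=0..k-4. (-1) ^ j * int ((k - 4 - j) choose j) * int (x2 k d (n - 3 - j))))"
      using gf_recurrence[OF n] sums[of "k - 1" n] sums[of "k - 1" "n - 1"] sums[of "k - 4" "n - 3"] n
        assms(1) unfolding of_int_add by simp
    then show "(\<Sum>j=0..k-1. (-1) ^ j * int ((k - 1 - j) choose j) * int (x2 k d (n - j))) =
      (\<Sum>j=0..k-1. (-1) ^ j * int ((k - 1 - j) choose j) * int (x2 k d (n - 1 - j))) +
      (\<Sum>j=0..k-4. (-1) ^ j * int ((k - 4 - j) choose j) * int (x2 k d (n - 3 - j)))"
      unfolding of_int_eq_iff .
  }
  show "real (x2 k d n) = 1 / (real n + 1) * real ((2 * n) choose n)" if "n \<le> k - 1"
    using that by (rule gf_catalan)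
  show "fps_to_fls (fps_compose (Abs_fps (\<lambda>n. real (x2 k d n))) (fps_X ^ 2)) =
           (U_at (k - 1) + fls_X ^ 2 * U_at (k - 3)) /
           (fls_X * (U_at k + fls_X ^ 2 * U_at (k - 2)))"
    using chebyshev_quotient[OF _ gf_quotient] assms(1) by (simp add: gf_def)
qed

end
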